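(* Let $d\ge 2$, let $\mathcal{Y}\in\mathbb{R}^{n_1\times\cdots\times n_d\times N}$ be an $N$-batch of $d$-dimensional tensors, let $\mathbf{T}$ be a (balanced binary) dimension tree for the first $d$ dimensions, and let $\varepsilon_{abs}$ be an absolute error tolerance. Let $\mathbf{H}_{\mathcal{Y}}$ be the batch hierarchical Tucker approximation of $\mathcal{Y}$, with dimension tree $\mathbf{T}$ and cores $\mathcal{G}_{\ell,j}$, computed by the algorithm BHT-l2r (described in the context) with node-wise truncation tolerance $\varepsilon_{nw}$. Let $\tilde{\mathcal{Y}}$ be the tensor reconstructed from $\mathbf{H}_{\mathcal{Y}}$. If the node-wise tolerance is chosen as $$\varepsilon_{nw}=\frac{\varepsilon_{abs}}{\sqrt{2d-2}},$$ then $\|\mathcal{Y}-\tilde{\mathcal{Y}}\|_F\le \varepsilon_{abs}$.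
   Context: Notation. $\|\cdot\|_F$ is the Frobenius norm. The mode-$i$ unfolding of a tensor $\mathcal{A}$ is the matrix $A_{(i)}$ whose rows are indexed by the $i$-th index and whose columns are indexed by all other indices. Contracting mode $i$ of $\mathcal{A}$ with $U^T$ means multiplying $A_{(i)}$ on the left by $U^T$ and folding back. Dimension tree. $\mathbf{T}$ is a binary tree with $2d-1$ nodes $\mathbf{N}_{\ell,j}$, where $\ell=0,\dots,p$ is the layer (distance from the root $\mathbf{N}_{0,1}$) and $j=1,\dots,|\mathbf{T}_\ell|$, with $|\mathbf{T}_\ell|$ the number of nodes in layer $\ell$. Its $d$ leaves are in bijection with the dimensions $1,\dots,d$ (the batch dimension of size $N$ is not in the tree). Every non-leaf node has two ordered successors in the next layer. Non-root, non-leaf nodes are called transfer nodes. The tree is balanced: $p=\lceil\log_2 d\rceil$, and leaves occur only in layers $p$ and $p-1$. The dimensions are arranged so that siblings are adjacent. Batch hierarchical Tucker (batch HT) format. Each node carries a core: a leaf for dimension $i$ carries a matrix $\mathcal{G}_{\ell,j}\in\mathbb{R}^{n_i\times r_{\ell,j}}$; a transfer node with successors $\mathbf{N}_{\ell+1,a},\mathbf{N}_{\ell+1,b}$ carries $\mathcal{G}_{\ell,j}\in\mathbb{R}^{r_{\ell+1,a}\times r_{\ell+1,b}\times r_{\ell,j}}$; the root carries $\mathcal{G}_{0,1}\in\mathbb{R}^{r_{1,1}\times r_{1,2}\times N}$, whose third index is the batch index. The reconstruction is obtained by contracting all cores along the edges of $\mathbf{T}$ (the last mode of each non-root core is contracted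 with the corresponding one of the first two modes of its parent's core); the result is a tensor in $\mathbb{R}^{n_1\times\cdots\times n_d\times N}$. Algorithm BHT-l2r (leaves to root), with node-wise tolerance $\varepsilon_{nw}$. Set $\mathcal{C}_p=\mathcal{Y}$. For $\ell=p,p-1,\dots,1$: (1) For each node $\mathbf{N}_{\ell,j}$ in layer $\ell$, take the unfolding of $\mathcal{C}_\ell$ in the mode corresponding to that node (for $\ell=p$ this is the mode of the dimension of the leaf $\mathbf{N}_{p,j}$; for $\ell<p$ it is mode $j$) and compute a truncated SVD $U_{\ell,j}\Sigma_{\ell,j}V_{\ell,j}^T$ of it whose residual $E_{\ell,j}$ (unfolding minus truncated SVD) satisfies $\|E_{\ell,j}\|_F\le\varepsilon_{nw}$; let $r_{\ell,j}$ be the truncation rank. The matrix $U_{\ell,j}$ of left singular vectors (orthonormal columns) is the core $\mathcal{G}_{\ell,j}$ if the node is a leaf, and is reshaped into $\mathcal{G}_{\ell,j}\in\mathbb{R}^{r_{\ell+1,a}\times r_{\ell+1,b}\times r_{\ell,j}}$ if it is a transfer node with successors $\mathbf{N}_{\ell+1,a},\mathbf{N}_{\ell+1,b}$. (2) Contract $\mathcal{C}_\ell$ in all the modes corresponding to nodes of layer $\ell$ with the matrices $U_{\ell,j}^T$, giving $\bar{\mathcal{C}}_\ell$. (3) If $\ell>1$, reshape $\bar{\mathcal{C}}_\ell$ into $\mathcal{C}_{\ell-1}$, which has one mode per node of layer $\ell-1$ (of size $n_i$ for a leaf of dimension $i$, and of size the product of the ranks of the two successors for a transfer node, merging the modes of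 these successors) plus the untouched batch mode of size $N$. Finally $\mathcal{G}_{0,1}=\bar{\mathcal{C}}_1\in\mathbb{R}^{r_{1,1}\times r_{1,2}\times N}$. No SVD is performed for the batch mode. *)

theory Defs
  imports Complex_Main "Jordan_Normal_Form.Matrix"
begin

text \<open>All indices (modes, layers, positions within a layer, tensor entries) start at 0.\<close>

section \<open>Tensors\<close>

text \<open>A tensor of order \<open>length (dims A)\<close>; the values of \<open>entry A\<close> outside
  \<open>indices (dims A)\<close> are irrelevant.\<close>

datatype tensor = Tensor (dims: "nat list") (entry: "nat list \<Rightarrow> real")

definition indices :: "nat list \<Rightarrow> nat list set" where
  "indices ns = {is. list_all2 (<) is ns}"

instantiation tensor :: minus
begin
definition minus_tensor :: "tensor \<Rightarrow> tensor \<Rightarrow> tensor" where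
  "A - B = Tensor (dims A) (\<lambda>is. entry A is - entry B is)"
instance ..
end

definition tensor_frob :: "tensor \<Rightarrow> real" where
  "tensor_frob A = sqrt (\<Sum>is\<in>indices (dims A). (entry A is)\<^sup>2)"

definition mat_frob :: "real mat \<Rightarrow> real" where
  "mat_frob M = sqrt (\<Sum>i<dim_row M. \<Sum>j<dim_col M. (M $$ (i, j))\<^sup>2)"

text \<open>Row-major linear index, a bijection from \<open>indices ns\<close> to \<open>{..<prod_list ns}\<close>. The same
  convention is used for the columns of unfoldings, for merging modes and for folding
  matrices into transfer cores.\<close>

fun lin :: "nat list \<Rightarrow> nat list \<Rightarrow> nat" where
  "lin (n # ns) (i # is) = i * prod_list ns + lin ns is"
| "lin _ _ = 0"

definition unlin :: "nat list \<Rightarrow> nat \<Rightarrow> nat list" where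
  "unlin ns = inv_into (indices ns) (lin ns)"

definition del_nth :: "nat \<Rightarrow> 'a list \<Rightarrow> 'a list" where
  "del_nth k xs = take k xs @ drop (Suc k) xs"

definition ins_nth :: "nat \<Rightarrow> 'a \<Rightarrow> 'a list \<Rightarrow> 'a list" where
  "ins_nth k x xs = take k xs @ x # drop k xs"

definition unfold_mode :: "nat \<Rightarrow> tensor \<Rightarrow> real mat" where
  "unfold_mode k A =
     (let ns = del_nth k (dims A)
      in mat (dims A ! k) (prod_list ns) (\<lambda>(i, c). entry A (ins_nth k i (unlin ns c))))"

definition fold_mode :: "nat \<Rightarrow> nat list \<Rightarrow> real mat \<Rightarrow> tensor" where
  "fold_mode k ns M = Tensor ns (\<lambda>is. M $$ (is ! k, lin (del_nth k ns) (del_nth k is)))"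

definition mode_mult :: "nat \<Rightarrow> real mat \<Rightarrow> tensor \<Rightarrow> tensor" where
  "mode_mult k M A = fold_mode k ((dims A)[k := dim_row M]) (M * unfold_mode k A)"


section \<open>Truncated singular value decomposition\<close>

definition svd :: "real mat \<Rightarrow> real mat \<Rightarrow> real mat \<Rightarrow> real mat \<Rightarrow> bool" where
  "svd A U S V \<longleftrightarrow>
     (let m = dim_row A; n = dim_col A in
      U \<in> carrier_mat m m \<and> S \<in> carrier_mat m n \<and> V \<in> carrier_mat n n \<and>
      transpose_mat U * U = 1\<^sub>m m \<and> transpose_mat V * V = 1\<^sub>m n \<and>
      diagonal_mat S \<and>
      (\<forall>i<min m n. 0 \<le> S $$ (i, i)) \<and>
      (\<forall>i j. i \<le> j \<longrightarrow> j < min m n \<longrightarrow> S $$ (j, j) \<le> S $$ (i, i)) \<and>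
      A = U * S * transpose_mat V)"

definition leading_block :: "nat \<Rightarrow> nat \<Rightarrow> real mat \<Rightarrow> real mat" where
  "leading_block m n M = mat m n (\<lambda>ij. M $$ ij)"

text \<open>The truncation rank is \<open>dim_col U = r\<close>.\<close>

definition truncated_svd :: "real mat \<Rightarrow> real mat \<Rightarrow> real mat \<Rightarrow> real mat \<Rightarrow> bool" where
  "truncated_svd A U S V \<longleftrightarrow>
     (\<exists>U' S' V' r. svd A U' S' V' \<and> r \<le> min (dim_row A) (dim_col A) \<and>
        U = leading_block (dim_row A) r U' \<and>
        S = leading_block r r S' \<and>
        V = leading_block (dim_col A) r V')"


section \<open>Dimension trees\<close>

datatype dim_tree = Leaf (leaf_dim: nat) | Node dim_tree dim_tree

primrec leaves :: "dim_tree \<Rightarrow> nat list" where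
  "leaves (Leaf i) = [i]"
| "leaves (Node a b) = leaves a @ leaves b"

primrec depth :: "dim_tree \<Rightarrow> nat" where
  "depth (Leaf i) = 0"
| "depth (Node a b) = Suc (max (depth a) (depth b))"

primrec successors :: "dim_tree \<Rightarrow> dim_tree list" where
  "successors (Leaf i) = []"
| "successors (Node a b) = [a, b]"

text \<open>A node is addressed by its layer \<open>l\<close> and its position \<open>j\<close>, from left to right, in that
  layer; the subtree below it is \<open>layer T l ! j\<close>.\<close>

primrec layer :: "dim_tree \<Rightarrow> nat \<Rightarrow> dim_tree list" where
  "layer T 0 = [T]"
| "layer T (Suc l) = concat (map successors (layer T l))"

text \<open>The successors of the non-leaf node \<open>(l, j)\<close> are \<open>(Suc l, a)\<close> and \<open>(Suc l, Suc a)\<close>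
  for \<open>a = first_succ T l j\<close>.\<close>

definition first_succ :: "dim_tree \<Rightarrow> nat \<Rightarrow> nat \<Rightarrow> nat" where
  "first_succ T l j = 2 * length (filter (\<lambda>s. \<not> is_Leaf s) (take j (layer T l)))"

text \<open>Siblings must sit at adjacent modes of the tensor in which their modes get merged. For
  siblings that are not both leaves this holds by the left-to-right numbering of the nodes, so
  only pairs of sibling leaves need a condition.\<close>

definition dimension_tree :: "nat \<Rightarrow> dim_tree \<Rightarrow> bool" where
  "dimension_tree d T \<longleftrightarrow>
     distinct (leaves T) \<and> set (leaves T) = {..<d} \<and>
     int (depth T) = \<lceil>log 2 (real d)\<rceil> \<and>
     (\<forall>l i. Leaf i \<in> set (layer T l) \<longrightarrow> l = depth T \<or> Suc l = depth T) \<and>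
     (\<forall>l i i'. Node (Leaf i) (Leaf i') \<in> set (layer T l) \<longrightarrow> i' = Suc i)"


section \<open>Batch hierarchical Tucker format\<close>

text \<open>\<open>G l j\<close> is the core of node \<open>(l, j)\<close>: a tensor of order 2 for a leaf and of order 3
  otherwise, the last mode of \<open>G 0 0\<close> being the batch mode.

  \<open>contract_cores T G s l j\<close> contracts the cores of the subtree \<open>s\<close> at node \<open>(l, j)\<close> of \<open>T\<close>
  along all its edges. The result is evaluated at position \<open>is ! i\<close> in each dimension \<open>i\<close> of
  the subtree and at position \<open>k\<close> in the last mode of \<open>G l j\<close>.\<close>

primrec contract_cores ::
  "dim_tree \<Rightarrow> (nat \<Rightarrow> nat \<Rightarrow> tensor) \<Rightarrow> dim_tree \<Rightarrow> nat \<Rightarrow> nat \<Rightarrow> nat list \<Rightarrow> nat \<Rightarrow> real" where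
  "contract_cores T G (Leaf i) = (\<lambda>l j is k. entry (G l j) [is ! i, k])"
| "contract_cores T G (Node s t) = (\<lambda>l j is k.
     \<Sum>x<dims (G l j) ! 0. \<Sum>y<dims (G l j) ! 1.
       entry (G l j) [x, y, k]
       * contract_cores T G s (Suc l) (first_succ T l j) is x
       * contract_cores T G t (Suc l) (Suc (first_succ T l j)) is y)"

text \<open>The number of rows of the core of the leaf of dimension \<open>i\<close>.\<close>

primrec leaf_size ::
  "dim_tree \<Rightarrow> (nat \<Rightarrow> nat \<Rightarrow> tensor) \<Rightarrow> nat \<Rightarrow> dim_tree \<Rightarrow> nat \<Rightarrow> nat \<Rightarrow> nat" where
  "leaf_size T G i (Leaf i') = (\<lambda>l j. dims (G l j) ! 0)"
| "leaf_size T G i (Node s t) = (\<lambda>l j.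
     if i \<in> set (leaves s) then leaf_size T G i s (Suc l) (first_succ T l j)
     else leaf_size T G i t (Suc l) (Suc (first_succ T l j)))"

definition reconstruct :: "dim_tree \<Rightarrow> (nat \<Rightarrow> nat \<Rightarrow> tensor) \<Rightarrow> tensor" where
  "reconstruct T G =
     (let d = length (leaves T) in
      Tensor (map (\<lambda>i. leaf_size T G i T 0 0) [0..<d] @ [dims (G 0 0) ! 2])
             (\<lambda>is. contract_cores T G T 0 0 is (is ! d)))"


section \<open>The leaves-to-root algorithm\<close>

text \<open>The mode of the layer-\<open>l\<close> tensor that belongs to node \<open>(l, j)\<close>.\<close>

definition node_mode :: "dim_tree \<Rightarrow> nat \<Rightarrow> nat \<Rightarrow> nat" where
  "node_mode T l j = (if l = depth T then leaf_dim (layer T l ! j) else j)"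

definition contract_layer :: "dim_tree \<Rightarrow> nat \<Rightarrow> (nat \<Rightarrow> real mat) \<Rightarrow> tensor \<Rightarrow> tensor" where
  "contract_layer T l U C =
     fold (\<lambda>j. mode_mult (node_mode T l j) (transpose_mat (U j))) [0..<length (layer T l)] C"

text \<open>For a tensor of the shape of the contracted layer-\<open>Suc l\<close> tensor, with mode sizes \<open>ns\<close>:
  the modes that make up mode \<open>j\<close> of the layer-\<open>l\<close> tensor. In a dimension tree a leaf outside
  the last layer occurs only for \<open>Suc l = depth T\<close>, where modes are dimensions.\<close>

definition source_modes :: "dim_tree \<Rightarrow> nat \<Rightarrow> nat \<Rightarrow> nat list" where
  "source_modes T l j =
     (case layer T l ! j of
        Leaf i \<Rightarrow> [i]
      | Node s t \<Rightarrow> [node_mode T (Suc l) (first_succ T l j),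
                      node_mode T (Suc l) (Suc (first_succ T l j))])"

definition merged_dims :: "dim_tree \<Rightarrow> nat \<Rightarrow> nat list \<Rightarrow> nat list" where
  "merged_dims T l ns =
     map (\<lambda>j. prod_list (map ((!) ns) (source_modes T l j))) [0..<length (layer T l)] @ [last ns]"

definition merge_index :: "dim_tree \<Rightarrow> nat \<Rightarrow> nat list \<Rightarrow> nat list \<Rightarrow> nat list" where
  "merge_index T l ns is =
     map (\<lambda>j. lin (map ((!) ns) (source_modes T l j)) (map ((!) is) (source_modes T l j)))
         [0..<length (layer T l)] @ [last is]"

definition merge_modes :: "dim_tree \<Rightarrow> nat \<Rightarrow> tensor \<Rightarrow> tensor" where
  "merge_modes T l C =
     Tensor (merged_dims T l (dims C))
            (\<lambda>is. entry C (inv_into (indices (dims C)) (merge_index T l (dims C)) is))"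

definition node_core :: "dim_tree \<Rightarrow> (nat \<Rightarrow> nat \<Rightarrow> real mat) \<Rightarrow> nat \<Rightarrow> nat \<Rightarrow> tensor" where
  "node_core T U l j =
     (if is_Leaf (layer T l ! j)
      then Tensor [dim_row (U l j), dim_col (U l j)] (\<lambda>is. U l j $$ (is ! 0, is ! 1))
      else let a = first_succ T l j;
               ra = dim_col (U (Suc l) a);
               rb = dim_col (U (Suc l) (Suc a))
           in Tensor [ra, rb, dim_col (U l j)]
                     (\<lambda>is. U l j $$ (lin [ra, rb] [is ! 0, is ! 1], is ! 2)))"

text \<open>\<open>BHT_l2r T Y eps G\<close>: the cores \<open>G\<close> are a possible output for input \<open>Y\<close> and node-wise
  tolerance \<open>eps\<close>. This is a relation since neither the singular vectors nor the truncation
  ranks are uniquely determined.\<close>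

definition BHT_l2r :: "dim_tree \<Rightarrow> tensor \<Rightarrow> real \<Rightarrow> (nat \<Rightarrow> nat \<Rightarrow> tensor) \<Rightarrow> bool" where
  "BHT_l2r T Y eps G \<longleftrightarrow>
     (\<exists>C Cbar U.
        C (depth T) = Y \<and>
        (\<forall>l\<in>{1..depth T}.
           (\<forall>j<length (layer T l).
              (\<exists>S V. truncated_svd (unfold_mode (node_mode T l j) (C l)) (U l j) S V \<and>
                     mat_frob (unfold_mode (node_mode T l j) (C l)
                               - U l j * S * transpose_mat V) \<le> eps) \<and>
              G l j = node_core T U l j) \<and>
           Cbar l = contract_layer T l (U l) (C l) \<and>
           (l > 1 \<longrightarrow> C (l - 1) = merge_modes T (l - 1) (Cbar l))) \<and>
        G 0 0 = Cbar 1)"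

end

theory Submission
  imports Defs
begin

text \<open>
  Fix a run of the algorithm on a tree of depth \<open>p\<close>. Let \<open>A\<^sub>l\<close> expand the contracted tensor
  \<open>Cbar l\<close> back to the shape of \<open>C l\<close> by multiplying every mode of a layer-\<open>l\<close> node with
  \<open>U l j\<close>, and let \<open>Z l\<close> be the approximation of \<open>C l\<close> that the cores above layer \<open>l\<close> and the
  matrices of layer \<open>l\<close> encode: \<open>Z 1\<close> is \<open>A\<^sub>1\<close> applied to the root core, and \<open>Z (l + 1)\<close> is
  \<open>A\<^bsub>l+1\<^esub>\<close> applied to \<open>Z l\<close> with its merged modes split again. The reconstruction is \<open>Z p\<close>.

  The error is estimated by a telescoping Pythagoras argument. If \<open>U\<close> has orthonormal columns,
  then \<open>f - U U\<^sup>T f\<close> is orthogonal to the range of \<open>U\<close>, so the squared distance from \<open>f\<close> to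
  \<open>U g\<close> is the squared projection error of \<open>f\<close> plus the squared distance from \<open>U\<^sup>T f\<close> to \<open>g\<close>
  (\<open>mode_pythagoras\<close>). Peeling off the nodes of a layer one by one costs one projection
  error per node. The tensor being projected has by then been contracted in other modes, but
  products in different modes commute and contractions do not increase norms, so that each
  error is bounded by the one for the uncontracted tensor \<open>C l\<close> (\<open>layer_pythagoras\<close>). The
  orthogonal projection is the best approximation in the range of \<open>U\<close>, hence this error is at
  most the residual of the truncated SVD (\<open>proj_error_truncated_svd\<close>). Merging modes only
  relabels entries and preserves the norm (\<open>sqdist_merge_modes\<close>). Consequently every node
  other than the root contributes at most \<open>eps\<^sup>2\<close> to the squared error; a binary tree with \<open>d\<close>
  leaves has \<open>2 d - 2\<close> such nodes (\<open>sum_length_nonroot_layers\<close>), and the choice of the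
  node-wise tolerance gives the claim.

  It remains to see that contracting the cores along the tree yields \<open>Z p\<close>. Each entry of the
  reconstruction is a multilinear form in the layer tensors: evaluate every mode of \<open>Cbar l\<close> on
  the vector that the contracted subtree below the corresponding node provides. Expansion with
  the matrices \<open>U l j\<close> (\<open>multilinear_eval_layer\<close>) and splitting of modes
  (\<open>multilinear_eval_grouped\<close>) transport this form from \<open>Cbar 1\<close>, where it is the contraction
  of the root core, down to \<open>Z p\<close>, where all vectors are unit vectors and the form just reads
  off an entry. Both statements about \<open>Z l\<close> are carried through one induction on \<open>l\<close>
  (\<open>partial_reconstruction\<close>).
\<close>

section \<open>Multi-indices\<close>

lemma indices_iff:
  "is \<in> indices ns \<longleftrightarrow> length is = length ns \<and> (\<forall>k<length ns. is ! k < ns ! k)"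
  by (auto simp: indices_def list_all2_conv_all_nth)

lemma indices_Nil [simp]: "indices [] = {[]}"
  by (auto simp: indices_def)

lemma indices_Cons: "indices (n # ns) = (\<lambda>(i, is). i # is) ` ({..<n} \<times> indices ns)"
  by (auto simp: indices_def list_all2_Cons2 image_iff)

lemma sum_indices_Cons:
  "(\<Sum>is\<in>indices (n # ns). F is) = (\<Sum>i<n. \<Sum>is\<in>indices ns. F (i # is))"
proof -
  have "inj_on (\<lambda>(i, is). i # is) ({..<n} \<times> indices ns)"
    by (auto simp: inj_on_def)
  then show ?thesis
    unfolding indices_Cons by (simp only: sum.reindex sum.cartesian_product o_def case_prod_unfold)
qed

lemma finite_indices [simp]: "finite (indices ns)"
  by (induction ns) (simp_all add: indices_Cons)

lemma card_indices: "card (indices ns) = prod_list ns"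
proof -
  have "(\<Sum>is\<in>indices ns. 1) = prod_list ns"
  proof (induction ns)
    case (Cons n ns)
    then have "(\<Sum>is\<in>indices (n # ns). 1) = (\<Sum>i<n. prod_list ns)"
      by (simp only: sum_indices_Cons)
    then show ?case by simp
  qed simp
  then show ?thesis by simp
qed

lemma lin_less: "is \<in> indices ns \<Longrightarrow> lin ns is < prod_list ns"
proof (induction ns arbitrary: "is")
  case (Cons n ns)
  then obtain i js where idx: "is = i # js" "i < n" "js \<in> indices ns"
    by (auto simp: indices_Cons)
  have "i * prod_list ns + lin ns js < i * prod_list ns + prod_list ns"
    using Cons.IH idx by simp
  also have "\<dots> = Suc i * prod_list ns" by simp
  also have "\<dots> \<le> n * prod_list ns" using idx by (intro mult_right_mono) auto
  finally show ?case using idx by simp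
qed simp

lemma inj_on_lin: "inj_on (lin ns) (indices ns)"
proof (induction ns)
  case (Cons n ns)
  show ?case
  proof (rule inj_onI)
    fix xs ys assume "xs \<in> indices (n # ns)" "ys \<in> indices (n # ns)"
      and eq: "lin (n # ns) xs = lin (n # ns) ys"
    then obtain i js i' js' where x: "xs = i # js" "js \<in> indices ns"
      and y: "ys = i' # js'" "js' \<in> indices ns"
      by (auto simp: indices_Cons)
    have l: "lin ns js < prod_list ns" "lin ns js' < prod_list ns"
      using x y lin_less by auto
    have e: "i * prod_list ns + lin ns js = i' * prod_list ns + lin ns js'"
      using eq x y by simp
    have "i = i'" using arg_cong[OF e, of "\<lambda>n. n div prod_list ns"] l by simp
    moreover have "js = js'" using e \<open>i = i'\<close> Cons x y by (auto dest: inj_onD)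
    ultimately show "xs = ys" using x y by simp
  qed
qed simp

text \<open>Injectivity suffices, since domain and codomain have the same finite cardinality.\<close>

lemma bij_betw_lin: "bij_betw (lin ns) (indices ns) {..<prod_list ns}"
  unfolding bij_betw_def
  by (intro conjI inj_on_lin card_subset_eq)
    (auto simp: lin_less card_image[OF inj_on_lin] card_indices)

lemma unlin_lin: "is \<in> indices ns \<Longrightarrow> unlin ns (lin ns is) = is"
  by (simp add: unlin_def inj_on_lin)

lemma ins_nth_del_nth: "k < length xs \<Longrightarrow> ins_nth k x (del_nth k xs) = xs[k := x]"
  by (simp add: ins_nth_def del_nth_def upd_conv_take_nth_drop min_def)

lemma del_nth_ins_nth: "k \<le> length xs \<Longrightarrow> del_nth k (ins_nth k x xs) = xs"
  by (simp add: ins_nth_def del_nth_def min_def)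

lemma nth_ins_nth: "k \<le> length xs \<Longrightarrow> ins_nth k x xs ! k = x"
  by (simp add: ins_nth_def nth_append)

lemma ins_nth_update: "k \<le> length xs \<Longrightarrow> (ins_nth k x xs)[k := y] = ins_nth k y xs"
  by (simp add: ins_nth_def list_update_append min_def)

lemma del_nth_update [simp]: "del_nth k (xs[k := x]) = del_nth k xs"
  by (simp add: del_nth_def)

lemma length_del_nth: "k < length xs \<Longrightarrow> length (del_nth k xs) = length xs - 1"
  by (simp add: del_nth_def)

lemma del_nth_indices: "is \<in> indices ns \<Longrightarrow> del_nth k is \<in> indices (del_nth k ns)"
  by (auto simp: indices_def del_nth_def intro!: list_all2_appendI list_all2_takeI list_all2_dropI)

lemma ins_nth_indices:
  assumes "k < length ns" "js \<in> indices (del_nth k ns)" "i < n"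
  shows "ins_nth k i js \<in> indices (ns[k := n])"
proof -
  have "length js = length (del_nth k ns)"
    using assms by (auto simp: indices_iff)
  moreover have "list_all2 (<) js (del_nth k ns)"
    using assms by (auto simp: indices_def)
  ultimately have "list_all2 (<) (ins_nth k i js) (ins_nth k n (del_nth k ns))"
    using assms unfolding ins_nth_def
    by (auto intro!: list_all2_appendI list_all2_takeI list_all2_dropI)
  then show ?thesis
    using assms by (simp add: indices_def ins_nth_del_nth)
qed

lemma update_indices:
  "is \<in> indices ns \<Longrightarrow> i < n \<Longrightarrow> is[k := i] \<in> indices (ns[k := n])"
  by (simp add: indices_def list_all2_update_cong)

text \<open>A sum over all entries is a sum over the fibres in direction of mode \<open>k\<close>; operations on a
  single mode can then be treated vector by vector. The form \<open>ns[k := n]\<close> covers tensors of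
  which only the size of mode \<open>k\<close> has changed.\<close>

lemma sum_indices_fibres:
  assumes "k < length ns"
  shows "(\<Sum>is\<in>indices (ns[k := n]). F is)
       = (\<Sum>js\<in>indices (del_nth k ns). \<Sum>i<n. F (ins_nth k i js))"
proof -
  have len: "length js = length ns - 1" if "js \<in> indices (del_nth k ns)" for js
    using that assms by (simp add: indices_iff length_del_nth)
  have "(\<Sum>is\<in>indices (ns[k := n]). F is)
      = (\<Sum>(js, i)\<in>indices (del_nth k ns) \<times> {..<n}. F (ins_nth k i js))"
  proof (rule sum.reindex_bij_witness[where i = "\<lambda>(js, i). ins_nth k i js"
        and j = "\<lambda>is. (del_nth k is, is ! k)"])
    fix "is" assume "is": "is \<in> indices (ns[k := n])"
    show "(case (del_nth k is, is ! k) of (js, i) \<Rightarrow> ins_nth k i js) = is"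
      using "is" assms by (simp add: ins_nth_del_nth indices_iff)
    then show "(case (del_nth k is, is ! k) of (js, i) \<Rightarrow> F (ins_nth k i js)) = F is"
      by simp
    have "del_nth k is \<in> indices (del_nth k ns)"
      using del_nth_indices[OF "is", of k] by simp
    moreover have "is ! k < n"
      using "is" assms by (auto simp: indices_iff dest!: spec[of _ k])
    ultimately show "(del_nth k is, is ! k) \<in> indices (del_nth k ns) \<times> {..<n}"
      by simp
  next
    fix p assume "p \<in> indices (del_nth k ns) \<times> {..<n}"
    then obtain js i where p: "p = (js, i)" "js \<in> indices (del_nth k ns)" "i < n" by auto
    then have "k \<le> length js" using len assms by simp
    then show "(del_nth k (case p of (js, i) \<Rightarrow> ins_nth k i js),
                (case p of (js, i) \<Rightarrow> ins_nth k i js) ! k) = p"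
      using p by (simp add: del_nth_ins_nth nth_ins_nth)
    show "(case p of (js, i) \<Rightarrow> ins_nth k i js) \<in> indices (ns[k := n])"
      using p assms by (simp add: ins_nth_indices)
  qed
  then show ?thesis by (simp add: sum.cartesian_product)
qed

lemma sum_lessThan_mult:
  "(\<Sum>r<a * b. F r) = (\<Sum>x<a. \<Sum>y<b. F (x * b + y))" for F :: "nat \<Rightarrow> 'a :: comm_monoid_add"
proof -
  have "(\<Sum>r = x * b..<x * b + b. F r) = (\<Sum>y<b. F (x * b + y))" for x
    using sum.shift_bounds_nat_ivl[of F 0 "x * b" b] by (simp add: add.commute atLeast0LessThan)
  then show ?thesis by (simp flip: sum.nat_group)
qed


section \<open>Mode products and orthogonal projections\<close>

text \<open>The entries of \<open>mode_mult k M A\<close> as an operation on entry functions alone. Unfolding, folding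
  and the tensor dimensions disappear, so products in different modes commute as an equation
  between functions, not just on the valid indices.\<close>

definition mode_prod :: "nat \<Rightarrow> real mat \<Rightarrow> (nat list \<Rightarrow> real) \<Rightarrow> nat list \<Rightarrow> real" where
  "mode_prod k M f is = (\<Sum>i<dim_col M. M $$ (is ! k, i) * f (is[k := i]))"

lemma dims_mode_mult [simp]: "dims (mode_mult k M A) = (dims A)[k := dim_row M]"
  by (simp add: mode_mult_def fold_mode_def)

lemma entry_mode_mult:
  assumes "k < length (dims A)" "dim_col M = dims A ! k"
    and "is": "is \<in> indices (dims (mode_mult k M A))"
  shows "entry (mode_mult k M A) is = mode_prod k M (entry A) is"
proof -
  have len: "k < length is" using assms by (simp add: indices_iff)
  have i: "is ! k < dim_row M" using "is" assms by (auto simp: indices_iff dest!: spec[of _ k])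
  have del: "del_nth k is \<in> indices (del_nth k (dims A))"
    using del_nth_indices[OF "is", of k] by simp
  have "entry (mode_mult k M A) is
      = (M * unfold_mode k A) $$ (is ! k, lin (del_nth k (dims A)) (del_nth k is))"
    by (simp add: mode_mult_def fold_mode_def)
  also have "\<dots> = (\<Sum>a<dims A ! k. M $$ (is ! k, a) * entry A (is[k := a]))"
    using lin_less[OF del] i len assms
    by (simp add: unfold_mode_def Let_def scalar_prod_def unlin_lin[OF del] ins_nth_del_nth
        atLeast0LessThan)
  finally show ?thesis by (simp add: mode_prod_def assms)
qed

lemma mode_prod_cong:
  assumes "\<And>is. is \<in> indices ns \<Longrightarrow> f is = g is"
    and "is \<in> indices (ns[k := n])" "dim_col M = ns ! k"
  shows "mode_prod k M f is = mode_prod k M g is"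
  unfolding mode_prod_def
proof (intro sum.cong arg_cong2[where f = "(*)"] refl)
  fix i assume "i \<in> {..<dim_col M}"
  then have "is[k := i] \<in> indices (ns[k := n, k := ns ! k])"
    using assms by (intro update_indices) auto
  then show "f (is[k := i]) = g (is[k := i])" using assms by simp
qed

lemma mode_prod_commute:
  assumes "j \<noteq> k"
  shows "mode_prod j M (mode_prod k M' f) = mode_prod k M' (mode_prod j M f)"
proof
  fix "is"
  have "mode_prod j M (mode_prod k M' f) is
      = (\<Sum>a<dim_col M. \<Sum>b<dim_col M'. M $$ (is ! j, a) *
           (M' $$ (is ! k, b) * f (is[k := b, j := a])))"
    using assms by (simp add: mode_prod_def sum_distrib_left list_update_swap[of j k])
  also have "\<dots> = (\<Sum>b<dim_col M'. \<Sum>a<dim_col M. M $$ (is ! j, a) *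
           (M' $$ (is ! k, b) * f (is[k := b, j := a])))"
    by (rule sum.swap)
  also have "\<dots> = mode_prod k M' (mode_prod j M f) is"
    using assms by (simp add: mode_prod_def sum_distrib_left mult.left_commute)
  finally show "mode_prod j M (mode_prod k M' f) is = mode_prod k M' (mode_prod j M f) is" .
qed

lemma mode_prod_diff:
  "mode_prod k M (\<lambda>is. f is - g is) is = mode_prod k M f is - mode_prod k M g is"
  by (simp add: mode_prod_def algebra_simps sum_subtractf)

lemma mode_prod_zero: "mode_prod k M (\<lambda>is. 0) is = 0"
  by (simp add: mode_prod_def)

definition orthonormal_cols :: "real mat \<Rightarrow> bool" where
  "orthonormal_cols U \<longleftrightarrow> transpose_mat U * U = 1\<^sub>m (dim_col U)"

lemma orthonormal_colsD:
  assumes "orthonormal_cols U" "a < dim_col U" "b < dim_col U"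
  shows "(\<Sum>i<dim_row U. U $$ (i, a) * U $$ (i, b)) = (if a = b then 1 else 0)"
proof -
  have "(transpose_mat U * U) $$ (a, b) = (if a = b then 1 else 0)"
    using assms by (simp add: orthonormal_cols_def)
  moreover have "(transpose_mat U * U) $$ (a, b) = (\<Sum>i<dim_row U. U $$ (i, a) * U $$ (i, b))"
    using assms by (simp add: scalar_prod_def atLeast0LessThan)
  ultimately show ?thesis by simp
qed

text \<open>With \<open>u\<close> the matrix of the \<open>r\<close> orthonormal columns, this is
  \<open>\<parallel>x - u y\<parallel>\<^sup>2 = \<parallel>x - u u\<^sup>T x\<parallel>\<^sup>2 + \<parallel>u\<^sup>T x - y\<parallel>\<^sup>2\<close>: split \<open>x - u y\<close> into the residual
  \<open>e = x - u u\<^sup>T x\<close>, which is orthogonal to all columns, and \<open>u z\<close> with \<open>z = u\<^sup>T x - y\<close>, whose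
  norm is that of \<open>z\<close>.\<close>

lemma orthonormal_pythagoras:
  fixes u :: "nat \<Rightarrow> nat \<Rightarrow> real"
  assumes "\<And>a b. a < r \<Longrightarrow> b < r \<Longrightarrow> (\<Sum>i<n. u i a * u i b) = (if a = b then 1 else 0)"
  shows "(\<Sum>i<n. (x i - (\<Sum>a<r. u i a * y a))\<^sup>2)
       = (\<Sum>i<n. (x i - (\<Sum>a<r. u i a * (\<Sum>m<n. u m a * x m)))\<^sup>2)
         + (\<Sum>a<r. ((\<Sum>m<n. u m a * x m) - y a)\<^sup>2)"
proof -
  define t where "t a = (\<Sum>m<n. u m a * x m)" for a
  define z where "z a = t a - y a" for a
  define e where "e i = x i - (\<Sum>a<r. u i a * t a)" for i
  have "x i - (\<Sum>a<r. u i a * y a) = e i + (\<Sum>a<r. u i a * z a)" for i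
    by (simp add: e_def z_def algebra_simps sum_subtractf)
  then have "(\<Sum>i<n. (x i - (\<Sum>a<r. u i a * y a))\<^sup>2)
      = (\<Sum>i<n. (e i)\<^sup>2) + 2 * (\<Sum>i<n. e i * (\<Sum>a<r. u i a * z a))
        + (\<Sum>i<n. (\<Sum>a<r. u i a * z a)\<^sup>2)"
    by (simp add: power2_sum sum.distrib sum_distrib_left mult_ac)
  moreover have "(\<Sum>i<n. e i * (\<Sum>a<r. u i a * z a)) = 0"
  proof -
    have orth: "(\<Sum>i<n. u i a * e i) = 0" if "a < r" for a
    proof -
      have "(\<Sum>i<n. u i a * (\<Sum>b<r. u i b * t b)) = (\<Sum>b<r. (\<Sum>i<n. u i a * u i b) * t b)"
        unfolding sum_distrib_left sum_distrib_right
        by (subst sum.swap) (simp add: mult_ac)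
      also have "\<dots> = (\<Sum>b<r. if a = b then t b else 0)"
        using that by (intro sum.cong) (auto simp: assms)
      also have "\<dots> = t a" using that by simp
      finally show ?thesis
        by (simp add: e_def right_diff_distrib sum_subtractf t_def)
    qed
    have "(\<Sum>i<n. e i * (\<Sum>a<r. u i a * z a)) = (\<Sum>a<r. (\<Sum>i<n. u i a * e i) * z a)"
      unfolding sum_distrib_left sum_distrib_right
      by (subst sum.swap) (simp add: mult_ac)
    then show ?thesis by (simp add: orth)
  qed
  moreover have "(\<Sum>i<n. (\<Sum>a<r. u i a * z a)\<^sup>2) = (\<Sum>a<r. (z a)\<^sup>2)"
  proof -
    have "(\<Sum>i<n. (\<Sum>a<r. u i a * z a)\<^sup>2)
        = (\<Sum>i<n. \<Sum>a<r. \<Sum>b<r. (u i a * u i b) * (z a * z b))"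
      by (simp add: power2_eq_square sum_product mult_ac)
    also have "\<dots> = (\<Sum>a<r. \<Sum>i<n. \<Sum>b<r. (u i a * u i b) * (z a * z b))"
      by (rule sum.swap)
    also have "\<dots> = (\<Sum>a<r. \<Sum>b<r. (\<Sum>i<n. u i a * u i b) * (z a * z b))"
      unfolding sum_distrib_right by (intro sum.cong refl sum.swap)
    also have "\<dots> = (\<Sum>a<r. \<Sum>b<r. if a = b then z a * z b else 0)"
      by (intro sum.cong) (auto simp: assms)
    finally show ?thesis by (simp add: power2_eq_square)
  qed
  ultimately show ?thesis by (simp add: e_def z_def t_def)
qed

definition sqdist :: "nat list \<Rightarrow> (nat list \<Rightarrow> real) \<Rightarrow> (nat list \<Rightarrow> real) \<Rightarrow> real" where
  "sqdist ns f g = (\<Sum>is\<in>indices ns. (f is - g is)\<^sup>2)"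

lemma sqdist_cong:
  assumes "\<And>is. is \<in> indices ns \<Longrightarrow> f is = f' is" "\<And>is. is \<in> indices ns \<Longrightarrow> g is = g' is"
  shows "sqdist ns f g = sqdist ns f' g'"
  using assms by (simp add: sqdist_def)

lemma sqdist_nonneg: "0 \<le> sqdist ns f g"
  by (simp add: sqdist_def sum_nonneg)

lemma mode_prod_fibre:
  assumes "k \<le> length js"
  shows "mode_prod k M f (ins_nth k i js) = (\<Sum>a<dim_col M. M $$ (i, a) * f (ins_nth k a js))"
  using assms by (simp add: mode_prod_def nth_ins_nth ins_nth_update)

definition proj_error :: "nat list \<Rightarrow> nat \<Rightarrow> real mat \<Rightarrow> (nat list \<Rightarrow> real) \<Rightarrow> real" where
  "proj_error ns k U f = sqdist ns f (mode_prod k U (mode_prod k (transpose_mat U) f))"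

text \<open>The Pythagoras identity summed over the fibres of mode \<open>k\<close>. It serves three purposes: as a
  recursion that replaces a tensor by its contraction, as best-approximation property of the
  projection, and as proof that contractions do not increase distances.\<close>

lemma mode_pythagoras:
  assumes k: "k < length ns" and U: "orthonormal_cols U" "dim_row U = ns ! k"
  shows "sqdist ns f (mode_prod k U g)
       = proj_error ns k U f
         + sqdist (ns[k := dim_col U]) (mode_prod k (transpose_mat U) f) g"
proof -
  have len: "k \<le> length js" if "js \<in> indices (del_nth k ns)" for js
    using that k by (simp add: indices_iff length_del_nth)
  have fibres: "(\<Sum>is\<in>indices ns. F is)
      = (\<Sum>js\<in>indices (del_nth k ns). \<Sum>i<dim_row U. F (ins_nth k i js))" for F :: "_ \<Rightarrow> real"
    using sum_indices_fibres[OF k, where n = "ns ! k"] U by simp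
  show ?thesis
    unfolding sqdist_def proj_error_def fibres sum_indices_fibres[OF k] sum.distrib[symmetric]
  proof (intro sum.cong refl)
    fix js assume "js \<in> indices (del_nth k ns)"
    note js = len[OF this]
    show "(\<Sum>i<dim_row U. (f (ins_nth k i js) - mode_prod k U g (ins_nth k i js))\<^sup>2) =
      (\<Sum>i<dim_row U. (f (ins_nth k i js) -
          mode_prod k U (mode_prod k (transpose_mat U) f) (ins_nth k i js))\<^sup>2) +
      (\<Sum>i<dim_col U. (mode_prod k (transpose_mat U) f (ins_nth k i js) - g (ins_nth k i js))\<^sup>2)"
      using orthonormal_pythagoras[OF orthonormal_colsD[OF U(1)],
          of "dim_col U" "\<lambda>i. f (ins_nth k i js)" "\<lambda>i. g (ins_nth k i js)"]
      by (simp add: mode_prod_fibre[OF js])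
  qed
qed

lemma mode_prod_contraction:
  assumes "k < length ns" "orthonormal_cols U" "dim_row U = ns ! k"
  shows "sqdist (ns[k := dim_col U])
           (mode_prod k (transpose_mat U) f) (mode_prod k (transpose_mat U) g)
       \<le> sqdist ns f g"
proof -
  have "sqdist ns (\<lambda>is. f is - g is) (mode_prod k U (\<lambda>is. 0))
      \<ge> sqdist (ns[k := dim_col U]) (mode_prod k (transpose_mat U) (\<lambda>is. f is - g is)) (\<lambda>is. 0)"
    unfolding mode_pythagoras[OF assms] by (simp add: proj_error_def sqdist_nonneg)
  then show ?thesis by (simp add: sqdist_def mode_prod_zero mode_prod_diff)
qed

text \<open>The projection in mode \<open>k\<close> commutes with the contraction in mode \<open>j\<close>, so the projection error
  of the contracted tensor is the norm of a contracted residual.\<close>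

lemma proj_error_contraction:
  assumes "j \<noteq> k" "j < length ns" "orthonormal_cols V" "dim_row V = ns ! j"
  shows "proj_error (ns[j := dim_col V]) k U (mode_prod j (transpose_mat V) f)
       \<le> proj_error ns k U f"
proof -
  have "mode_prod k U (mode_prod k (transpose_mat U) (mode_prod j (transpose_mat V) f))
      = mode_prod j (transpose_mat V) (mode_prod k U (mode_prod k (transpose_mat U) f))"
    by (simp only: mode_prod_commute[OF assms(1), of "transpose_mat V"])
  then show ?thesis
    using mode_prod_contraction[OF assms(2-4)] by (simp add: proj_error_def)
qed

text \<open>Every matrix of the form \<open>U * B\<close> is the unfolding of some mode product with \<open>U\<close>, and the
  projection is at least as close as any of those.\<close>

lemma proj_error_le_mat_frob:
  assumes k: "k < length (dims A)" and U: "orthonormal_cols U" "dim_row U = dims A ! k"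
    and B: "B \<in> carrier_mat (dim_col U) (prod_list (del_nth k (dims A)))"
  shows "proj_error (dims A) k U (entry A) \<le> (mat_frob (unfold_mode k A - U * B))\<^sup>2"
proof -
  let ?ns = "dims A" and ?ms = "del_nth k (dims A)"
  \<comment> \<open>the tensor that unfolds to \<open>B\<close>\<close>
  define g where "g is = B $$ (is ! k, lin ?ms (del_nth k is))" for "is"
  have "(mat_frob (unfold_mode k A - U * B))\<^sup>2
      = (\<Sum>i<?ns ! k. \<Sum>c<prod_list ?ms. ((unfold_mode k A - U * B) $$ (i, c))\<^sup>2)"
    using U B by (simp add: mat_frob_def sum_nonneg)
  also have "\<dots> = (\<Sum>c<prod_list ?ms. \<Sum>i<?ns ! k. ((unfold_mode k A - U * B) $$ (i, c))\<^sup>2)"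
    by (rule sum.swap)
  also have "\<dots> = (\<Sum>js\<in>indices ?ms. \<Sum>i<?ns ! k. ((unfold_mode k A - U * B) $$ (i, lin ?ms js))\<^sup>2)"
    by (rule sum.reindex_bij_betw[OF bij_betw_lin, symmetric])
  also have "\<dots> = (\<Sum>js\<in>indices ?ms. \<Sum>i<?ns ! k.
      (entry A (ins_nth k i js) - mode_prod k U g (ins_nth k i js))\<^sup>2)"
  proof (intro sum.cong refl arg_cong[where f = "\<lambda>x. x\<^sup>2"])
    fix js i assume js: "js \<in> indices ?ms" and i: "i \<in> {..<?ns ! k}"
    have k': "k \<le> length js" using js k by (simp add: indices_iff length_del_nth)
    have "(U * B) $$ (i, lin ?ms js) = mode_prod k U g (ins_nth k i js)"
      using U B i lin_less[OF js] unfolding mode_prod_fibre[OF k']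
      by (simp add: g_def nth_ins_nth[OF k'] del_nth_ins_nth[OF k'] scalar_prod_def atLeast0LessThan)
    moreover have "unfold_mode k A $$ (i, lin ?ms js) = entry A (ins_nth k i js)"
      using i lin_less[OF js] by (simp add: unfold_mode_def Let_def unlin_lin[OF js])
    ultimately show "(unfold_mode k A - U * B) $$ (i, lin ?ms js)
        = entry A (ins_nth k i js) - mode_prod k U g (ins_nth k i js)"
      using U B i lin_less[OF js] by simp
  qed
  also have "\<dots> = sqdist ?ns (entry A) (mode_prod k U g)"
    unfolding sqdist_def by (subst sum_indices_fibres[OF k, where n = "?ns ! k", simplified]) simp
  finally show ?thesis
    unfolding mode_pythagoras[OF k U] by (simp add: sqdist_nonneg)
qed

text \<open>The form in which the error analysis uses a truncated SVD: \<open>U\<close> spans the range of a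
  projection, and \<open>S * transpose_mat V\<close> has the shape required of the second factor of the
  approximation.\<close>

lemma truncated_svd_orthonormal:
  assumes "truncated_svd A U S V"
  shows "orthonormal_cols U" "dim_row U = dim_row A"
    "S \<in> carrier_mat (dim_col U) (dim_col U)" "V \<in> carrier_mat (dim_col A) (dim_col U)"
proof -
  obtain U' S' V' r where svd: "svd A U' S' V'" and r: "r \<le> min (dim_row A) (dim_col A)"
    and U: "U = leading_block (dim_row A) r U'"
    and S: "S = leading_block r r S'" and V: "V = leading_block (dim_col A) r V'"
    using assms by (auto simp: truncated_svd_def)
  have U': "U' \<in> carrier_mat (dim_row A) (dim_row A)" "orthonormal_cols U'"
    using svd unfolding svd_def Let_def orthonormal_cols_def by (blast, metis carrier_matD(2))
  show "dim_row U = dim_row A" "S \<in> carrier_mat (dim_col U) (dim_col U)"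
    "V \<in> carrier_mat (dim_col A) (dim_col U)"
    by (auto simp: U S V leading_block_def)
  show "orthonormal_cols U"
    unfolding orthonormal_cols_def
  proof (rule eq_matI)
    fix i j assume "i < dim_row (1\<^sub>m (dim_col U) :: real mat)" "j < dim_col (1\<^sub>m (dim_col U) :: real mat)"
    then have ij: "i < r" "j < r" by (auto simp: U leading_block_def)
    then show "(transpose_mat U * U) $$ (i, j) = 1\<^sub>m (dim_col U) $$ (i, j)"
      using orthonormal_colsD[OF U'(2), of i j] U' r
      by (simp add: U leading_block_def scalar_prod_def atLeast0LessThan)
  qed auto
qed

lemma proj_error_truncated_svd:
  assumes "k < length (dims A)" and svd: "truncated_svd (unfold_mode k A) U S V"
    and res: "mat_frob (unfold_mode k A - U * S * transpose_mat V) \<le> eps"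
  shows "proj_error (dims A) k U (entry A) \<le> eps\<^sup>2"
proof -
  note svd' = truncated_svd_orthonormal[OF svd]
  have dims: "dim_row (unfold_mode k A) = dims A ! k"
    "dim_col (unfold_mode k A) = prod_list (del_nth k (dims A))"
    by (auto simp: unfold_mode_def Let_def)
  have "U * S * transpose_mat V = U * (S * transpose_mat V)"
    using svd' by (intro assoc_mult_mat) auto
  moreover have "proj_error (dims A) k U (entry A)
      \<le> (mat_frob (unfold_mode k A - U * (S * transpose_mat V)))\<^sup>2"
    using assms svd' dims by (intro proj_error_le_mat_frob) auto
  moreover have "0 \<le> mat_frob (unfold_mode k A - U * S * transpose_mat V)"
    by (simp add: mat_frob_def sum_nonneg)
  ultimately show ?thesis using res by (metis order_trans power_mono)
qed


section \<open>All nodes of a layer at once\<close>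

lemma proj_error_cong:
  assumes "\<And>is. is \<in> indices ns \<Longrightarrow> f is = g is" "dim_row U = ns ! k" "k < length ns"
  shows "proj_error ns k U f = proj_error ns k U g"
  unfolding proj_error_def
proof (rule sqdist_cong)
  fix "is" assume "is \<in> indices ns"
  then have "is \<in> indices (ns[k := dim_col U, k := ns ! k])" by simp
  then show "mode_prod k U (mode_prod k (transpose_mat U) f) is
      = mode_prod k U (mode_prod k (transpose_mat U) g) is"
  proof (rule mode_prod_cong[rotated])
    fix js assume "js \<in> indices (ns[k := dim_col U])"
    then show "mode_prod k (transpose_mat U) f js = mode_prod k (transpose_mat U) g js"
      using assms by (intro mode_prod_cong[where ns = ns]) auto
  qed (use assms in simp)
qed (use assms in simp)

text \<open>The functions \<open>\<kappa>\<close> and \<open>U\<close> assign to each label, in a layer the position of a node, its mode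
  and its matrix.\<close>

definition contract_dims :: "('a \<Rightarrow> nat) \<Rightarrow> ('a \<Rightarrow> real mat) \<Rightarrow> 'a list \<Rightarrow> nat list \<Rightarrow> nat list" where
  "contract_dims \<kappa> U = fold (\<lambda>j ns. ns[\<kappa> j := dim_col (U j)])"

lemma contract_dims_simps [simp]:
  "contract_dims \<kappa> U [] ns = ns"
  "contract_dims \<kappa> U (j # js) ns = contract_dims \<kappa> U js (ns[\<kappa> j := dim_col (U j)])"
  by (simp_all add: contract_dims_def)

lemma length_contract_dims [simp]: "length (contract_dims \<kappa> U js ns) = length ns"
  by (induction js arbitrary: ns) auto

lemma contract_dims_other:
  "k \<notin> \<kappa> ` set js \<Longrightarrow> contract_dims \<kappa> U js ns ! k = ns ! k"
  by (induction js arbitrary: ns) auto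

lemma contract_dims_mode:
  assumes "distinct js" "inj_on \<kappa> (set js)" "j \<in> set js" "\<kappa> j < length ns"
  shows "contract_dims \<kappa> U js ns ! \<kappa> j = dim_col (U j)"
  using assms
proof (induction js arbitrary: ns)
  case (Cons i js)
  show ?case
  proof (cases "i = j")
    case True
    then have "\<kappa> j \<notin> \<kappa> ` set js" using Cons.prems by (auto dest: inj_onD)
    then show ?thesis using True Cons.prems by (simp add: contract_dims_other)
  qed (use Cons in auto)
qed simp

lemma dims_fold_mode_mult:
  "dims (fold (\<lambda>j. mode_mult (\<kappa> j) (transpose_mat (U j))) js A) = contract_dims \<kappa> U js (dims A)"
  by (induction js arbitrary: A) auto

text \<open>Induction on the list of nodes with the tensor generalized: \<open>mode_pythagoras\<close> contracts the
  mode of the first node and the induction hypothesis applies to the contracted tensor. Its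
  projection errors are bounded by those of the original tensor by \<open>proj_error_contraction\<close>, which
  is where the distinctness of the modes enters.\<close>

lemma layer_pythagoras:
  assumes "distinct js" "inj_on \<kappa> (set js)"
    and "\<And>j. j \<in> set js \<Longrightarrow> \<kappa> j < length (dims A)"
    and "\<And>j. j \<in> set js \<Longrightarrow> orthonormal_cols (U j)"
    and "\<And>j. j \<in> set js \<Longrightarrow> dim_row (U j) = dims A ! \<kappa> j"
  shows "sqdist (dims A) (entry A) (foldr (\<lambda>j. mode_prod (\<kappa> j) (U j)) js g)
       \<le> (\<Sum>j\<leftarrow>js. proj_error (dims A) (\<kappa> j) (U j) (entry A))
         + sqdist (contract_dims \<kappa> U js (dims A))
             (entry (fold (\<lambda>j. mode_mult (\<kappa> j) (transpose_mat (U j))) js A)) g"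
  using assms
proof (induction js arbitrary: A)
  case (Cons j js)
  define A' where "A' = mode_mult (\<kappa> j) (transpose_mat (U j)) A"
  have dims: "dims A' = (dims A)[\<kappa> j := dim_col (U j)]" by (simp add: A'_def)
  have j: "\<kappa> j < length (dims A)" "orthonormal_cols (U j)" "dim_row (U j) = dims A ! \<kappa> j"
    using Cons.prems by auto
  have entry: "entry A' is = mode_prod (\<kappa> j) (transpose_mat (U j)) (entry A) is"
    if "is \<in> indices (dims A')" for "is"
    using j that unfolding A'_def by (intro entry_mode_mult) auto
  have ne: "\<kappa> j \<noteq> \<kappa> i" if "i \<in> set js" for i
    using Cons.prems(1,2) that by (auto dest: inj_onD)
  let ?g = "foldr (\<lambda>j. mode_prod (\<kappa> j) (U j)) js g"
  have "sqdist (dims A) (entry A) (mode_prod (\<kappa> j) (U j) ?g)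
      = proj_error (dims A) (\<kappa> j) (U j) (entry A)
        + sqdist (dims A') (mode_prod (\<kappa> j) (transpose_mat (U j)) (entry A)) ?g"
    by (simp only: mode_pythagoras[OF j] dims)
  also have "sqdist (dims A') (mode_prod (\<kappa> j) (transpose_mat (U j)) (entry A)) ?g
      = sqdist (dims A') (entry A') ?g"
    by (rule sqdist_cong) (simp_all add: entry)
  also have "\<dots> \<le> (\<Sum>i\<leftarrow>js. proj_error (dims A') (\<kappa> i) (U i) (entry A'))
         + sqdist (contract_dims \<kappa> U js (dims A'))
             (entry (fold (\<lambda>j. mode_mult (\<kappa> j) (transpose_mat (U j))) js A')) g"
    using Cons.prems ne by (intro Cons.IH) (auto simp: dims)
  also have "(\<Sum>i\<leftarrow>js. proj_error (dims A') (\<kappa> i) (U i) (entry A'))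
      \<le> (\<Sum>i\<leftarrow>js. proj_error (dims A) (\<kappa> i) (U i) (entry A))"
  proof (rule sum_list_mono)
    fix i assume i: "i \<in> set js"
    have "proj_error (dims A') (\<kappa> i) (U i) (entry A')
        = proj_error (dims A') (\<kappa> i) (U i) (mode_prod (\<kappa> j) (transpose_mat (U j)) (entry A))"
      using entry Cons.prems ne[OF i] i by (intro proj_error_cong) (auto simp: dims)
    also have "\<dots> \<le> proj_error (dims A) (\<kappa> i) (U i) (entry A)"
      unfolding dims using j ne[OF i] by (intro proj_error_contraction) auto
    finally show "proj_error (dims A') (\<kappa> i) (U i) (entry A')
        \<le> proj_error (dims A) (\<kappa> i) (U i) (entry A)" .
  qed
  finally show ?case by (simp add: A'_def)
qed simp


section \<open>Multilinear evaluation\<close>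

text \<open>The tensor \<open>f\<close> as a multilinear form, applied to the vector \<open>w k\<close> in mode \<open>k\<close>.\<close>

definition multilinear_eval ::
  "nat list \<Rightarrow> (nat list \<Rightarrow> real) \<Rightarrow> (nat \<Rightarrow> nat \<Rightarrow> real) \<Rightarrow> real" where
  "multilinear_eval ns f w = (\<Sum>is\<in>indices ns. f is * (\<Prod>k<length ns. w k (is ! k)))"

lemma multilinear_eval_cong:
  assumes "\<And>is. is \<in> indices ns \<Longrightarrow> f is = g is"
    and "\<And>k x. k < length ns \<Longrightarrow> x < ns ! k \<Longrightarrow> v k x = w k x"
  shows "multilinear_eval ns f v = multilinear_eval ns g w"
  unfolding multilinear_eval_def using assms
  by (intro sum.cong arg_cong2[where f = "(*)"] prod.cong) (auto simp: indices_iff)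

lemma multilinear_eval_point:
  assumes "is \<in> indices ns"
  shows "multilinear_eval ns f (\<lambda>k x. of_bool (x = is ! k)) = f is"
proof -
  have "(\<Prod>k<length ns. of_bool (js ! k = is ! k)) = (of_bool (js = is) :: real)"
    if js: "js \<in> indices ns" for js
  proof (cases "js = is")
    case False
    then obtain k where "k < length ns" "js ! k \<noteq> is ! k"
      using js assms unfolding indices_iff by (metis nth_equalityI)
    then have "(\<Prod>k<length ns. of_bool (js ! k = is ! k)) = (0 :: real)"
      by (intro prod_zero) auto
    then show ?thesis using False by simp
  qed simp
  then have "multilinear_eval ns f (\<lambda>k x. of_bool (x = is ! k))
      = (\<Sum>js\<in>indices ns. if js = is then f js else 0)"
    unfolding multilinear_eval_def by (intro sum.cong) auto
  then show ?thesis using assms by simp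
qed

text \<open>Moving a matrix from the tensor to the vector of its mode: \<open>(M f)(v) = f(M\<^sup>T v)\<close>.\<close>

lemma multilinear_eval_mode_prod:
  assumes k: "k < length ns" and M: "dim_row M = ns ! k"
  shows "multilinear_eval ns (mode_prod k M f) v
       = multilinear_eval (ns[k := dim_col M]) f
           (v(k := \<lambda>x. \<Sum>r<dim_row M. v k r * M $$ (r, x)))"
proof -
  let ?w = "v(k := \<lambda>x. \<Sum>r<dim_row M. v k r * M $$ (r, x))"
  \<comment> \<open>the weights of all modes but \<open>k\<close>, constant along a fibre of mode \<open>k\<close>\<close>
  let ?P = "\<lambda>js. \<Prod>m\<in>{..<length ns} - {k}. v m (ins_nth k 0 js ! m)"
  have len: "k \<le> length js" if "js \<in> indices (del_nth k ns)" for js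
    using that k by (simp add: indices_iff length_del_nth)
  have prod: "(\<Prod>m<length ns. u m (ins_nth k i js ! m)) = u k i * ?P js"
    if "k \<le> length js" "\<And>m. m \<noteq> k \<Longrightarrow> u m = v m" for u js i
  proof -
    have "ins_nth k i js ! m = ins_nth k 0 js ! m" if "m \<noteq> k" for m
      using ins_nth_update[OF \<open>k \<le> length js\<close>, of 0 i] that by (metis nth_list_update_neq)
    then have "(\<Prod>m\<in>{..<length ns} - {k}. u m (ins_nth k i js ! m)) = ?P js"
      using that by (intro prod.cong) auto
    then show ?thesis
      using k that(1) by (subst prod.remove[of _ k]) (auto simp: nth_ins_nth)
  qed
  have "multilinear_eval ns (mode_prod k M f) v
      = (\<Sum>js\<in>indices (del_nth k ns). \<Sum>i<dim_row M.
           (\<Sum>a<dim_col M. M $$ (i, a) * f (ins_nth k a js)) * (v k i * ?P js))"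
    unfolding multilinear_eval_def
    by (subst sum_indices_fibres[OF k, where n = "ns ! k", simplified])
      (simp add: M mode_prod_fibre[OF len] prod[OF len])
  also have "\<dots> = (\<Sum>js\<in>indices (del_nth k ns). \<Sum>a<dim_col M.
           f (ins_nth k a js) * ((\<Sum>r<dim_row M. v k r * M $$ (r, a)) * ?P js))"
  proof (rule sum.cong[OF refl])
    fix js
    show "(\<Sum>i<dim_row M. (\<Sum>a<dim_col M. M $$ (i, a) * f (ins_nth k a js)) * (v k i * ?P js))
        = (\<Sum>a<dim_col M. f (ins_nth k a js) * ((\<Sum>r<dim_row M. v k r * M $$ (r, a)) * ?P js))"
      unfolding sum_distrib_left sum_distrib_right
      by (subst sum.swap) (simp add: mult_ac)
  qed
  also have "\<dots> = multilinear_eval (ns[k := dim_col M]) f ?w"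
    unfolding multilinear_eval_def sum_indices_fibres[OF k] length_list_update
  proof (intro sum.cong refl)
    fix js a assume "js \<in> indices (del_nth k ns)"
    then show "f (ins_nth k a js) * ((\<Sum>r<dim_row M. v k r * M $$ (r, a)) * ?P js)
        = f (ins_nth k a js) * (\<Prod>m<length ns. ?w m (ins_nth k a js ! m))"
      using prod[OF len, of js ?w a] by simp
  qed
  finally show ?thesis .
qed

text \<open>The vectors \<open>w\<close> are only constrained on indices below the mode sizes, since the weights defined
  by subtrees of a dimension tree have no meaning beyond those.\<close>

lemma multilinear_eval_layer:
  assumes "distinct js" "inj_on \<kappa> (set js)"
    and "\<And>j. j \<in> set js \<Longrightarrow> \<kappa> j < length ns"
    and "\<And>j. j \<in> set js \<Longrightarrow> dim_row (U j) = ns ! \<kappa> j"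
    and "\<And>j x. j \<in> set js \<Longrightarrow> x < dim_col (U j) \<Longrightarrow>
           w (\<kappa> j) x = (\<Sum>r<dim_row (U j). v (\<kappa> j) r * U j $$ (r, x))"
    and "\<And>k x. k < length ns \<Longrightarrow> k \<notin> \<kappa> ` set js \<Longrightarrow> x < ns ! k \<Longrightarrow> w k x = v k x"
  shows "multilinear_eval ns (foldr (\<lambda>j. mode_prod (\<kappa> j) (U j)) js f) v
       = multilinear_eval (contract_dims \<kappa> U js ns) f w"
  using assms
proof (induction js arbitrary: ns v)
  case Nil
  then show ?case by (auto intro!: multilinear_eval_cong)
next
  case (Cons j js)
  let ?v = "v(\<kappa> j := \<lambda>x. \<Sum>r<dim_row (U j). v (\<kappa> j) r * U j $$ (r, x))"
  let ?ns = "ns[\<kappa> j := dim_col (U j)]"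
  have ne: "\<kappa> i \<noteq> \<kappa> j" if "i \<in> set js" for i
    using Cons.prems(1,2) that by (metis distinct.simps(2) inj_on_eq_iff list.set_intros)
  have "multilinear_eval ns (foldr (\<lambda>j. mode_prod (\<kappa> j) (U j)) (j # js) f) v
      = multilinear_eval ?ns (foldr (\<lambda>j. mode_prod (\<kappa> j) (U j)) js f) ?v"
    using Cons.prems by (simp add: multilinear_eval_mode_prod)
  also have "\<dots> = multilinear_eval (contract_dims \<kappa> U js ?ns) f w"
  proof (rule Cons.IH)
    fix k x assume "k < length ?ns" "k \<notin> \<kappa> ` set js" "x < ?ns ! k"
    then show "w k x = ?v k x"
      using Cons.prems(5)[of j x] Cons.prems(6)[of k x] by (cases "k = \<kappa> j") auto
  qed (use Cons.prems ne ne[symmetric] in auto)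
  finally show ?case by simp
qed


section \<open>Merging modes\<close>

text \<open>The list \<open>ks\<close> holds, for each mode after merging, the list of modes that it is made of. A mode
  that stays as it is forms a singleton group, so the batch mode needs no special treatment.\<close>

definition grouped_dims :: "nat list list \<Rightarrow> nat list \<Rightarrow> nat list" where
  "grouped_dims ks ns = map (\<lambda>s. prod_list (map ((!) ns) s)) ks"

definition grouped_index :: "nat list list \<Rightarrow> nat list \<Rightarrow> nat list \<Rightarrow> nat list" where
  "grouped_index ks ns is = map (\<lambda>s. lin (map ((!) ns) s) (map ((!) is) s)) ks"

lemma prod_list_concat_map:
  "prod_list (map f (concat xss)) = prod_list (map (\<lambda>xs. prod_list (map f xs)) xss)"
  for f :: "'a \<Rightarrow> 'b :: comm_monoid_mult"
  by (induction xss) auto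

text \<open>Each mode lies in a group, and \<open>lin\<close> is injective on that group, so the index can be recovered.
  Surjectivity follows by counting: both index sets have as many elements as the product of all
  mode sizes.\<close>

lemma bij_betw_grouped_index:
  assumes "distinct (concat ks)" "set (concat ks) = {..<length ns}"
  shows "bij_betw (grouped_index ks ns) (indices ns) (indices (grouped_dims ks ns))"
proof -
  have sub: "map ((!) is) s \<in> indices (map ((!) ns) s)" if "is \<in> indices ns" "s \<in> set ks" for "is" s
  proof -
    have "\<forall>k\<in>set s. k < length ns" using assms that by auto
    then show ?thesis using that by (auto simp: indices_iff)
  qed
  have into: "grouped_index ks ns ` indices ns \<subseteq> indices (grouped_dims ks ns)"
    using sub by (auto simp: grouped_index_def grouped_dims_def indices_def[of "map _ ks"]
        list_all2_map1 list_all2_map2 list_all2_same intro!: lin_less)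
  have inj: "inj_on (grouped_index ks ns) (indices ns)"
  proof (rule inj_onI)
    fix xs ys assume x: "xs \<in> indices ns" and y: "ys \<in> indices ns"
      and eq: "grouped_index ks ns xs = grouped_index ks ns ys"
    show "xs = ys"
    proof (rule nth_equalityI)
      fix k assume "k < length xs"
      then have "k \<in> set (concat ks)" using x assms by (simp add: indices_iff)
      then obtain s where s: "s \<in> set ks" "k \<in> set s" by auto
      then have "lin (map ((!) ns) s) (map ((!) xs) s) = lin (map ((!) ns) s) (map ((!) ys) s)"
        using eq by (simp add: grouped_index_def)
      then have "map ((!) xs) s = map ((!) ys) s"
        by (rule inj_onD[OF inj_on_lin _ sub[OF x s(1)] sub[OF y s(1)]])
      then show "xs ! k = ys ! k" using s by simp
    qed (use x y in \<open>simp add: indices_iff\<close>)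
  qed
  have "prod_list (grouped_dims ks ns) = prod_list (map ((!) ns) (concat ks))"
    by (simp add: grouped_dims_def prod_list_concat_map)
  also have "\<dots> = (\<Prod>k<length ns. ns ! k)"
    using assms by (metis prod.distinct_set_conv_list)
  also have "\<dots> = prod_list ns"
    by (simp add: prod.list_conv_set_nth atLeast0LessThan)
  finally show ?thesis
    unfolding bij_betw_def
    by (intro conjI inj card_subset_eq into) (simp_all add: card_image[OF inj] card_indices)
qed

text \<open>Merging is compatible with evaluation when the vector of each merged mode is the tensor product
  of the vectors of its modes.\<close>

lemma multilinear_eval_grouped:
  assumes ks: "distinct (concat ks)" "set (concat ks) = {..<length ns}"
    and v: "\<And>is j. is \<in> indices ns \<Longrightarrow> j < length ks \<Longrightarrow>
      v j (grouped_index ks ns is ! j) = (\<Prod>k\<leftarrow>ks ! j. w k (is ! k))"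
  shows "multilinear_eval (grouped_dims ks ns) f v
       = multilinear_eval ns (\<lambda>is. f (grouped_index ks ns is)) w"
proof -
  have "(\<Prod>j<length ks. v j (grouped_index ks ns is ! j)) = (\<Prod>k<length ns. w k (is ! k))"
    if "is \<in> indices ns" for "is"
  proof -
    have "(\<Prod>j<length ks. v j (grouped_index ks ns is ! j))
        = (\<Prod>j<length ks. \<Prod>k\<leftarrow>ks ! j. w k (is ! k))"
      using v that by (intro prod.cong) auto
    also have "\<dots> = prod_list (map (\<lambda>s. \<Prod>k\<leftarrow>s. w k (is ! k)) ks)"
      by (simp add: prod.list_conv_set_nth atLeast0LessThan)
    also have "\<dots> = (\<Prod>k\<leftarrow>concat ks. w k (is ! k))"
      by (simp add: prod_list_concat_map)
    also have "\<dots> = (\<Prod>k<length ns. w k (is ! k))"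
      using ks by (metis prod.distinct_set_conv_list)
    finally show ?thesis .
  qed
  then show ?thesis
    unfolding multilinear_eval_def
    by (subst sum.reindex_bij_betw[OF bij_betw_grouped_index[OF ks], symmetric])
      (simp add: grouped_dims_def)
qed

text \<open>\<open>K\<close> is the batch mode.\<close>

definition source_groups :: "dim_tree \<Rightarrow> nat \<Rightarrow> nat \<Rightarrow> nat list list" where
  "source_groups T l K = map (source_modes T l) [0..<length (layer T l)] @ [[K]]"

lemma merged_dims_grouped:
  "length ns = Suc K \<Longrightarrow> merged_dims T l ns = grouped_dims (source_groups T l K) ns"
  by (cases ns rule: rev_cases)
    (auto simp: merged_dims_def grouped_dims_def source_groups_def o_def nth_append)

lemma merge_index_grouped:
  assumes "length ns = Suc K" "is \<in> indices ns"
  shows "merge_index T l ns is = grouped_index (source_groups T l K) ns is"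
proof -
  have "length is = Suc K" using assms by (simp add: indices_iff)
  then show ?thesis
    by (cases "is" rule: rev_cases)
      (auto simp: merge_index_def grouped_index_def source_groups_def o_def nth_append)
qed

lemma bij_betw_merge_index:
  assumes "distinct (concat (source_groups T l K))"
    and "set (concat (source_groups T l K)) = {..<length ns}" "length ns = Suc K"
  shows "bij_betw (merge_index T l ns) (indices ns) (indices (merged_dims T l ns))"
  unfolding merged_dims_grouped[OF assms(3)]
  using bij_betw_grouped_index[OF assms(1,2)] merge_index_grouped[OF assms(3)]
  by (simp cong: bij_betw_cong)

lemma sqdist_merge_modes:
  assumes "distinct (concat (source_groups T l K))"
    and "set (concat (source_groups T l K)) = {..<length (dims A)}" "length (dims A) = Suc K"
  shows "sqdist (dims (merge_modes T l A)) (entry (merge_modes T l A)) g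
       = sqdist (dims A) (entry A) (\<lambda>is. g (merge_index T l (dims A) is))"
proof -
  note bij = bij_betw_merge_index[OF assms]
  show ?thesis
    unfolding sqdist_def merge_modes_def tensor.sel
    by (subst sum.reindex_bij_betw[OF bij, symmetric])
      (simp add: inv_into_f_f[OF bij_betw_imp_inj_on[OF bij]])
qed


section \<open>Layers of a dimension tree\<close>

lemma length_concat_successors:
  "length (concat (map successors ts)) = 2 * length (filter (\<lambda>s. \<not> is_Leaf s) ts)"
proof (induction ts)
  case (Cons t ts)
  then show ?case by (cases t) auto
qed simp

lemma first_succ_length: "first_succ T l j = length (concat (map successors (take j (layer T l))))"
  by (simp add: first_succ_def length_concat_successors)

text \<open>The successors of the nodes to the left of \<open>j\<close> fill exactly the positions before
  \<open>first_succ T l j\<close> in the next layer.\<close>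

lemma layer_successors:
  assumes "j < length (layer T l)" "layer T l ! j = Node s t"
  shows "Suc (first_succ T l j) < length (layer T (Suc l))"
    and "layer T (Suc l) ! first_succ T l j = s"
    and "layer T (Suc l) ! Suc (first_succ T l j) = t"
proof -
  have "layer T l = take j (layer T l) @ Node s t # drop (Suc j) (layer T l)"
    using assms by (metis id_take_nth_drop)
  then have "layer T (Suc l) = concat (map successors (take j (layer T l))) @ [s, t]
      @ concat (map successors (drop (Suc j) (layer T l)))"
    by (metis append_assoc concat.simps(2) concat_append layer.simps(2) list.simps(9) map_append
        successors.simps(2))
  then show "Suc (first_succ T l j) < length (layer T (Suc l))"
    "layer T (Suc l) ! first_succ T l j = s"
    "layer T (Suc l) ! Suc (first_succ T l j) = t"
    by (simp_all add: first_succ_length nth_append)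
qed

lemma layer_Leaf_Suc [simp]: "layer (Leaf i) (Suc l) = []"
  by (induction l) auto

lemma layer_Node_Suc: "layer (Node s t) (Suc l) = layer s l @ layer t l"
  by (induction l) auto

text \<open>By structural induction: a layer below the root consists of the corresponding layers of the two
  subtrees. The \<open>Suc\<close> avoids truncated subtraction, and \<open>p\<close> is arbitrary since the two subtrees
  may differ in depth.\<close>

lemma sum_length_layers:
  "depth T \<le> p \<Longrightarrow> Suc (\<Sum>l\<le>p. length (layer T l)) = 2 * length (leaves T)"
proof (induction T arbitrary: p)
  case (Leaf i)
  show ?case
    by (cases p) (simp_all add: sum.atMost_Suc_shift del: layer.simps(2) sum.atMost_Suc)
next
  case (Node s t)
  then obtain q where q: "p = Suc q" "depth s \<le> q" "depth t \<le> q" by (cases p) auto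
  have "(\<Sum>l\<le>p. length (layer (Node s t) l))
      = Suc ((\<Sum>l\<le>q. length (layer s l)) + (\<Sum>l\<le>q. length (layer t l)))"
    by (simp add: q(1) sum.atMost_Suc_shift layer_Node_Suc sum.distrib
        del: layer.simps(2) sum.atMost_Suc)
  then show ?case using Node.IH(1)[OF q(2)] Node.IH(2)[OF q(3)] by simp
qed

lemma depth_in_layer: "s \<in> set (layer T l) \<Longrightarrow> depth s + l \<le> depth T"
proof (induction l arbitrary: s)
  case (Suc l)
  then obtain u where u: "u \<in> set (layer T l)" "s \<in> set (successors u)" by auto
  from u(2) have "Suc (depth s) \<le> depth u" by (cases u) auto
  then show ?case using Suc.IH[OF u(1)] by simp
qed simp

lemma leaves_not_Nil [simp]: "leaves t \<noteq> []"
  by (induction t) auto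

text \<open>Passing to the next layer keeps the leaves in order but drops those that sit in the current
  layer.\<close>

lemma leaves_concat_successors:
  "set (concat (map leaves (concat (map successors ts)))) \<subseteq> set (concat (map leaves ts))"
  "distinct (concat (map leaves ts)) \<Longrightarrow>
     distinct (concat (map leaves (concat (map successors ts))))"
proof (induction ts)
  case (Cons t ts)
  { case 1 then show ?case using Cons.IH(1) by (cases t) auto }
  { case 2 then show ?case using Cons.IH by (cases t) auto }
qed auto

lemma distinct_leaves_layer: "distinct (leaves T) \<Longrightarrow> distinct (concat (map leaves (layer T l)))"
proof (induction l)
  case (Suc l)
  then show ?case unfolding layer.simps by (intro leaves_concat_successors(2))
qed simp

lemma leaves_layer_eq:
  "(\<And>k s. k < l \<Longrightarrow> s \<in> set (layer T k) \<Longrightarrow> \<not> is_Leaf s) \<Longrightarrow>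
     concat (map leaves (layer T l)) = leaves T"
proof (induction l)
  case (Suc l)
  have "concat (map leaves (concat (map successors ts))) = concat (map leaves ts)"
    if "\<forall>s\<in>set ts. \<not> is_Leaf s" for ts
    using that
  proof (induction ts)
    case (Cons t ts)
    then show ?case by (cases t) auto
  qed simp
  moreover have "\<forall>s\<in>set (layer T l). \<not> is_Leaf s" using Suc.prems by blast
  ultimately have "concat (map leaves (layer T (Suc l))) = concat (map leaves (layer T l))"
    by simp
  also have "\<dots> = leaves T" by (rule Suc.IH) (use Suc.prems in \<open>meson less_SucI\<close>)
  finally show ?case .
qed simp

locale balanced_tree =
  fixes d :: nat and T :: dim_tree
  assumes d: "d \<ge> 2" and T: "dimension_tree d T"
begin

text \<open>The number of modes of the layer-\<open>l\<close> tensor without the batch mode, which thus is the mode with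
  number \<open>num_modes l\<close>. In the last layer the modes are all \<open>d\<close> dimensions, including those whose
  leaves sit one layer above.\<close>

definition num_modes :: "nat \<Rightarrow> nat" where
  "num_modes l = (if l = depth T then d else length (layer T l))"

lemma distinct_leaves: "distinct (leaves T)" and set_leaves: "set (leaves T) = {..<d}"
  and leaf_layer: "Leaf i \<in> set (layer T l) \<Longrightarrow> l = depth T \<or> Suc l = depth T"
  and sibling_leaves: "Node (Leaf i) (Leaf i') \<in> set (layer T l) \<Longrightarrow> i' = Suc i"
  using T by (auto simp: dimension_tree_def)

lemma length_leaves: "length (leaves T) = d"
  using distinct_card[OF distinct_leaves] by (simp add: set_leaves)

lemma root_Node: obtains s t where "T = Node s t"
  using length_leaves d by (cases T) auto

lemma depth_pos: "depth T \<ge> 1"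
  by (rule root_Node) auto

lemma sum_length_nonroot_layers: "(\<Sum>l=1..depth T. length (layer T l)) = 2 * d - 2"
proof -
  have "(\<Sum>l\<le>depth T. length (layer T l)) = 1 + (\<Sum>l=1..depth T. length (layer T l))"
    by (simp add: atMost_atLeast0 sum.atLeast_Suc_atMost)
  then show ?thesis using sum_length_layers[of T "depth T"] by (simp add: length_leaves)
qed

lemma num_modes_1: "num_modes 1 = 2"
proof -
  have len: "length (layer T 1) = 2" by (rule root_Node) simp
  show ?thesis
  proof (cases "depth T = 1")
    case True
    then show ?thesis using sum_length_nonroot_layers len d by (simp add: num_modes_def del: layer.simps)
  qed (use len in \<open>simp add: num_modes_def\<close>)
qed

lemma is_Leaf_last_layer: "s \<in> set (layer T (depth T)) \<Longrightarrow> is_Leaf s"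
  using depth_in_layer[of s T "depth T"] by (cases s) auto

lemma leaves_subset:
  assumes "s \<in> set (layer T l)" shows "set (leaves s) \<subseteq> {..<d}"
proof -
  have "set (concat (map leaves (layer T l))) \<subseteq> set (leaves T)"
  proof (induction l)
    case (Suc l)
    then show ?case
      using leaves_concat_successors(1)[of "layer T l"]
      unfolding layer.simps by (rule order_trans[rotated])
  qed simp
  then show ?thesis using assms by (auto simp: set_leaves)
qed

lemma Node_layer_less:
  assumes "j < length (layer T l)" "layer T l ! j = Node s t" shows "l < depth T"
  using depth_in_layer[OF nth_mem[OF assms(1)]] assms(2) by simp

text \<open>The successors of a node in the last but one layer are leaves, whose modes are their
  dimensions.\<close>

lemma source_modes_eq_leaves:
  assumes "Suc l = depth T" "j < length (layer T l)"
  shows "source_modes T l j = leaves (layer T l ! j)"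
proof (cases "layer T l ! j")
  case (Node s t)
  note succ = layer_successors[OF assms(2) Node]
  have "is_Leaf s" "is_Leaf t"
    using succ assms(1) nth_mem[OF succ(1)] nth_mem[OF Suc_lessD[OF succ(1)]]
    by (auto intro!: is_Leaf_last_layer simp del: layer.simps)
  then have "leaves s = [leaf_dim s]" "leaves t = [leaf_dim t]"
    by (cases s; simp; fail) (cases t; use \<open>is_Leaf t\<close> in simp)
  then show ?thesis
    using Node succ assms(1) by (simp add: source_modes_def node_mode_def del: layer.simps)
qed (simp add: source_modes_def)

lemma concat_leaves_penultimate:
  assumes "Suc l = depth T"
  shows "concat (map leaves (layer T l)) = leaves T"
proof (rule leaves_layer_eq)
  fix k s assume "k < l" "s \<in> set (layer T k)"
  then show "\<not> is_Leaf s" using leaf_layer assms by (cases s) force+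
qed

text \<open>The source modes partition all modes. In the last but one layer they are the leaves of the whole
  tree, since no leaf sits higher up; in any layer above, all nodes have two successors and the
  source modes simply enumerate the next layer from left to right.\<close>

lemma concat_source_modes:
  assumes "l < depth T"
  shows "distinct (concat (map (source_modes T l) [0..<length (layer T l)]))"
    and "set (concat (map (source_modes T l) [0..<length (layer T l)])) = {..<num_modes (Suc l)}"
proof -
  let ?c = "concat (map (source_modes T l) [0..<length (layer T l)])"
  have "distinct ?c \<and> set ?c = {..<num_modes (Suc l)}"
  proof (cases "Suc l = depth T")
    case True
    have "map (source_modes T l) [0..<length (layer T l)] = map leaves (layer T l)"
      by (rule nth_equalityI) (simp_all add: source_modes_eq_leaves[OF True])
    then have "?c = leaves T" using concat_leaves_penultimate[OF True] by simp
    then show ?thesis using True by (simp add: distinct_leaves set_leaves num_modes_def)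
  next
    case False
    have node: "\<exists>s t. layer T l ! j = Node s t" if "j < length (layer T l)" for j
      using leaf_layer nth_mem[OF that] False assms by (cases "layer T l ! j") force+
    \<comment> \<open>the nodes to the left of \<open>j\<close> have the first \<open>first_succ T l j\<close> modes as sources\<close>
    have "concat (map (source_modes T l) [0..<j]) = [0..<first_succ T l j]"
      if "j \<le> length (layer T l)" for j
      using that
    proof (induction j)
      case (Suc j)
      then obtain s t where st: "layer T l ! j = Node s t" using node by (meson Suc_le_lessD)
      have "first_succ T l (Suc j) = Suc (Suc (first_succ T l j))"
        using Suc.prems st by (simp add: first_succ_def take_Suc_conv_app_nth)
      moreover have "source_modes T l j = [first_succ T l j, Suc (first_succ T l j)]"
        using st False by (simp add: source_modes_def node_mode_def)
      ultimately show ?case using Suc by simp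
    qed (simp add: first_succ_def)
    from this[OF order_refl] have "?c = [0..<length (layer T (Suc l))]"
      by (simp add: first_succ_length)
    then show ?thesis using False by (simp add: num_modes_def atLeast0LessThan del: layer.simps)
  qed
  then show "distinct ?c" "set ?c = {..<num_modes (Suc l)}" by auto
qed

lemma source_groups_partition:
  assumes "l < depth T"
  shows "distinct (concat (source_groups T l (num_modes (Suc l))))"
    and "set (concat (source_groups T l (num_modes (Suc l)))) = {..<Suc (num_modes (Suc l))}"
proof -
  have c: "concat (source_groups T l (num_modes (Suc l)))
      = concat (map (source_modes T l) [0..<length (layer T l)]) @ [num_modes (Suc l)]"
    by (simp add: source_groups_def)
  show "distinct (concat (source_groups T l (num_modes (Suc l))))"
    unfolding c distinct_append concat_source_modes(2)[OF assms]
    by (simp add: concat_source_modes(1)[OF assms])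
  show "set (concat (source_groups T l (num_modes (Suc l)))) = {..<Suc (num_modes (Suc l))}"
    unfolding c set_append concat_source_modes(2)[OF assms] by auto
qed

lemma map_leaf_dim_last_layer:
  "map leaf_dim (layer T (depth T)) = concat (map leaves (layer T (depth T)))"
proof -
  have "map leaf_dim ts = concat (map leaves ts)" if "\<forall>s\<in>set ts. is_Leaf s" for ts
    using that
  proof (induction ts)
    case (Cons t ts)
    then show ?case by (cases t) auto
  qed simp
  then show ?thesis using is_Leaf_last_layer by blast
qed

lemma inj_on_node_mode: "inj_on (node_mode T l) {..<length (layer T l)}"
proof (cases "l = depth T")
  case True
  have "distinct (map leaf_dim (layer T l))"
    unfolding True map_leaf_dim_last_layer by (rule distinct_leaves_layer[OF distinct_leaves])
  then show ?thesis
    using True by (fastforce simp: node_mode_def inj_on_def distinct_conv_nth)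
qed (simp add: node_mode_def inj_on_def)

lemma node_mode_less: "j < length (layer T l) \<Longrightarrow> node_mode T l j < num_modes l"
proof (cases "l = depth T")
  case True
  assume j: "j < length (layer T l)"
  then obtain i where "layer T l ! j = Leaf i"
    using is_Leaf_last_layer True nth_mem[OF j] by (metis dim_tree.collapse(1))
  then show ?thesis
    using leaves_subset[OF nth_mem[OF j]] True by (simp add: node_mode_def num_modes_def)
qed (simp add: node_mode_def num_modes_def)

text \<open>The dimension of a leaf above the last layer is a mode that the last layer leaves untouched:
  otherwise the dimension would also label a leaf below another node of the same layer,
  although the leaves are distinct.\<close>

lemma penultimate_leaf:
  assumes "l < depth T" "j < length (layer T l)" "layer T l ! j = Leaf i"
  shows "Suc l = depth T" and "i \<notin> node_mode T (Suc l) ` {..<length (layer T (Suc l))}"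
proof -
  have mem: "Leaf i \<in> set (layer T l)" using assms(2,3) by (metis nth_mem)
  show l: "Suc l = depth T" using leaf_layer[OF mem] assms(1) by auto
  show "i \<notin> node_mode T (Suc l) ` {..<length (layer T (Suc l))}"
  proof
    assume "i \<in> node_mode T (Suc l) ` {..<length (layer T (Suc l))}"
    then obtain k where k: "k < length (layer T (Suc l))" "i = leaf_dim (layer T (Suc l) ! k)"
      using l by (auto simp: node_mode_def simp del: layer.simps)
    have "is_Leaf (layer T (Suc l) ! k)"
      using k(1) l by (auto intro!: is_Leaf_last_layer simp del: layer.simps)
    then have "Leaf i \<in> set (layer T (Suc l))"
      using k by (metis dim_tree.collapse(1) nth_mem)
    then obtain u where u: "u \<in> set (layer T l)" "Leaf i \<in> set (successors u)" by auto
    from u(2) obtain s t where st: "u = Node s t" by (cases u) auto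
    then have "i \<in> set (leaves u)" using u by auto
    moreover have "distinct (concat (map leaves (layer T l)))"
      by (rule distinct_leaves_layer[OF distinct_leaves])
    moreover have "leaves u \<noteq> leaves (Leaf i)"
      using st by (simp add: append_eq_Cons_conv leaves_not_Nil)
    ultimately have "set (leaves u) \<inter> set (leaves (Leaf i)) = {}"
      using u mem unfolding distinct_concat_iff set_map by blast
    then show False using \<open>i \<in> set (leaves u)\<close> by simp
  qed
qed

end


section \<open>Mode sizes in a run of the algorithm\<close>

text \<open>The existential quantifiers of \<open>BHT_l2r\<close> opened. The merging step is indexed by the layer of its
  result.\<close>

locale BHT_run = balanced_tree d T for d T +
  fixes Y :: tensor and ns :: "nat list" and N :: nat
    and C Cbar :: "nat \<Rightarrow> tensor" and U :: "nat \<Rightarrow> nat \<Rightarrow> real mat"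
    and G :: "nat \<Rightarrow> nat \<Rightarrow> tensor" and eps :: real
  assumes ns: "length ns = d" and dims_Y: "dims Y = ns @ [N]"
    and C_last: "C (depth T) = Y"
    and svd: "1 \<le> l \<Longrightarrow> l \<le> depth T \<Longrightarrow> j < length (layer T l) \<Longrightarrow>
      \<exists>S V. truncated_svd (unfold_mode (node_mode T l j) (C l)) (U l j) S V \<and>
        mat_frob (unfold_mode (node_mode T l j) (C l) - U l j * S * transpose_mat V) \<le> eps"
    and core: "1 \<le> l \<Longrightarrow> l \<le> depth T \<Longrightarrow> j < length (layer T l) \<Longrightarrow> G l j = node_core T U l j"
    and Cbar: "1 \<le> l \<Longrightarrow> l \<le> depth T \<Longrightarrow> Cbar l = contract_layer T l (U l) (C l)"
    and C_merge: "1 \<le> l \<Longrightarrow> l < depth T \<Longrightarrow> C l = merge_modes T l (Cbar (Suc l))"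
    and G_root: "G 0 0 = Cbar 1"
begin

abbreviation nodes :: "nat \<Rightarrow> nat list" where
  "nodes l \<equiv> [0..<length (layer T l)]"

lemma orthonormal_U:
  assumes "1 \<le> l" "l \<le> depth T" "j < length (layer T l)"
  shows "orthonormal_cols (U l j)" and "dim_row (U l j) = dims (C l) ! node_mode T l j"
proof -
  obtain S V where "truncated_svd (unfold_mode (node_mode T l j) (C l)) (U l j) S V"
    using svd[OF assms] by blast
  from truncated_svd_orthonormal[OF this]
  show "orthonormal_cols (U l j)" "dim_row (U l j) = dims (C l) ! node_mode T l j"
    by (simp_all add: unfold_mode_def Let_def)
qed

lemma dims_Cbar:
  "1 \<le> l \<Longrightarrow> l \<le> depth T \<Longrightarrow> dims (Cbar l) = contract_dims (node_mode T l) (U l) (nodes l) (dims (C l))"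
  by (simp add: Cbar contract_layer_def dims_fold_mode_mult)

lemma dims_Cbar_other:
  assumes "1 \<le> l" "l \<le> depth T" "k \<notin> node_mode T l ` {..<length (layer T l)}"
  shows "dims (Cbar l) ! k = dims (C l) ! k"
  using assms by (simp add: dims_Cbar contract_dims_other atLeast0LessThan)

lemma batch_not_node_mode: "num_modes l \<notin> node_mode T l ` {..<length (layer T l)}"
  using node_mode_less by (metis imageE lessThan_iff less_irrefl)

text \<open>Downward induction, from the input tensor in the last layer towards the root.\<close>

lemma batch_mode:
  assumes "1 \<le> l" "l \<le> depth T"
  shows "length (dims (C l)) = Suc (num_modes l) \<and> dims (C l) ! num_modes l = N"
  using assms(2,1)
proof (induction rule: inc_induct)
  case base
  then show ?case by (simp add: C_last dims_Y num_modes_def nth_append ns)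
next
  case (step m)
  then have m: "1 \<le> m" "m < depth T" by auto
  have IH: "length (dims (C (Suc m))) = Suc (num_modes (Suc m))"
    "dims (C (Suc m)) ! num_modes (Suc m) = N"
    using step.IH by auto
  have len: "length (dims (Cbar (Suc m))) = Suc (num_modes (Suc m))"
    using m IH by (simp add: dims_Cbar)
  have N: "dims (Cbar (Suc m)) ! num_modes (Suc m) = N"
    using dims_Cbar_other[OF _ _ batch_not_node_mode, of "Suc m"] m IH by simp
  have "dims (C m) = grouped_dims (source_groups T m (num_modes (Suc m))) (dims (Cbar (Suc m)))"
    using m by (simp add: C_merge merge_modes_def merged_dims_grouped[OF len])
  then show ?case
    using m N by (simp add: grouped_dims_def source_groups_def num_modes_def[of m] nth_append)
qed

lemma length_dims_C: "1 \<le> l \<Longrightarrow> l \<le> depth T \<Longrightarrow> length (dims (C l)) = Suc (num_modes l)"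
  and batch_size_C: "1 \<le> l \<Longrightarrow> l \<le> depth T \<Longrightarrow> dims (C l) ! num_modes l = N"
  using batch_mode by auto

lemma length_dims_Cbar: "1 \<le> l \<Longrightarrow> l \<le> depth T \<Longrightarrow> length (dims (Cbar l)) = Suc (num_modes l)"
  by (simp add: dims_Cbar length_dims_C)

lemma batch_size_Cbar: "1 \<le> l \<Longrightarrow> l \<le> depth T \<Longrightarrow> dims (Cbar l) ! num_modes l = N"
  by (simp add: dims_Cbar_other batch_not_node_mode batch_size_C)

lemma dims_Cbar_node:
  assumes "1 \<le> l" "l \<le> depth T" "j < length (layer T l)"
  shows "dims (Cbar l) ! node_mode T l j = dim_col (U l j)"
  unfolding dims_Cbar[OF assms(1,2)]
  using assms inj_on_node_mode[of l] node_mode_less[OF assms(3)]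
  by (intro contract_dims_mode) (auto simp: atLeast0LessThan length_dims_C)

lemma dims_C_merged:
  assumes "1 \<le> l" "l < depth T"
  shows "dims (C l) = grouped_dims (source_groups T l (num_modes (Suc l))) (dims (Cbar (Suc l)))"
  using assms length_dims_Cbar[of "Suc l"]
  by (simp add: C_merge merge_modes_def merged_dims_grouped)

text \<open>A leaf in the last but one layer inherits the size of its dimension from the input tensor,
  because no node of the last layer touches that mode.\<close>

lemma dims_C_Leaf:
  assumes "1 \<le> l" "l \<le> depth T" "j < length (layer T l)" "layer T l ! j = Leaf i"
  shows "dims (C l) ! node_mode T l j = ns ! i" and "i < d"
proof -
  show i: "i < d" using leaves_subset[OF nth_mem[OF assms(3)]] assms(4) by simp
  show "dims (C l) ! node_mode T l j = ns ! i"
  proof (cases "l = depth T")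
    case True
    then show ?thesis using assms i by (simp add: node_mode_def C_last dims_Y nth_append ns)
  next
    case False
    then have l: "l < depth T" using assms by simp
    note pen = penultimate_leaf[OF l assms(3,4)]
    have "dims (Cbar (Suc l)) ! i = ns ! i"
      using dims_Cbar_other[OF _ _ pen(2)] pen(1) i by (simp add: C_last dims_Y nth_append ns)
    then show ?thesis
      using dims_C_merged[OF assms(1) l] assms(3,4) l
      by (simp add: node_mode_def grouped_dims_def source_groups_def nth_append source_modes_def)
  qed
qed

lemma dims_C_Node:
  assumes "1 \<le> l" "j < length (layer T l)" "layer T l ! j = Node s t"
  shows "dims (C l) ! node_mode T l j
       = dim_col (U (Suc l) (first_succ T l j)) * dim_col (U (Suc l) (Suc (first_succ T l j)))"
proof -
  have l: "l < depth T" using Node_layer_less[OF assms(2,3)] .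
  note succ = layer_successors[OF assms(2,3)]
  have "dims (Cbar (Suc l)) ! node_mode T (Suc l) (first_succ T l j)
      = dim_col (U (Suc l) (first_succ T l j))"
    "dims (Cbar (Suc l)) ! node_mode T (Suc l) (Suc (first_succ T l j))
      = dim_col (U (Suc l) (Suc (first_succ T l j)))"
    using l succ(1) by (auto intro!: dims_Cbar_node simp del: layer.simps)
  then show ?thesis
    using dims_C_merged[OF assms(1) l] assms(2,3) l
    by (simp add: node_mode_def[of T l] grouped_dims_def source_groups_def nth_append source_modes_def)
qed


section \<open>The multilinear form of a reconstructed entry\<close>

text \<open>The vector that the contracted subtree at node \<open>(l, j)\<close> contributes to the entry \<open>is\<close> of the
  reconstruction, indexed by the edge to the parent.\<close>

definition subtree_weight :: "nat list \<Rightarrow> nat \<Rightarrow> nat \<Rightarrow> nat \<Rightarrow> real" where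
  "subtree_weight is l j = contract_cores T G (layer T l ! j) l j is"

text \<open>The vectors on which \<open>Z l\<close>, which has the shape of \<open>C l\<close>, has to be evaluated. A leaf, the batch
  mode and the modes of the last layer select a single index. The index of a transfer
  node is a merged pair, which \<open>div\<close> and \<open>mod\<close> take apart according to the row-major
  convention; its weight is the product of those of the two subtrees below.\<close>

definition row_weight :: "nat list \<Rightarrow> nat \<Rightarrow> nat \<Rightarrow> nat \<Rightarrow> real" where
  "row_weight is l k r =
     (if k = num_modes l then of_bool (r = is ! d)
      else if l = depth T then of_bool (r = is ! k)
      else case layer T l ! k of
        Leaf i \<Rightarrow> of_bool (r = is ! i)
      | Node s t \<Rightarrow>
          (let a = first_succ T l k; rb = dim_col (U (Suc l) (Suc a))
           in subtree_weight is (Suc l) a (r div rb) * subtree_weight is (Suc l) (Suc a) (r mod rb)))"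

text \<open>The corresponding vectors for the shape of \<open>Cbar l\<close>. They differ from \<open>row_weight\<close> in the modes
  of the nodes of layer \<open>l\<close>, where the matrix of the node has been absorbed.\<close>

definition col_weight :: "nat list \<Rightarrow> nat \<Rightarrow> nat \<Rightarrow> nat \<Rightarrow> real" where
  "col_weight is l k =
     (if k \<in> node_mode T l ` {..<length (layer T l)}
      then subtree_weight is l (inv_into {..<length (layer T l)} (node_mode T l) k)
      else row_weight is l k)"

lemma col_weight_node:
  "j < length (layer T l) \<Longrightarrow> col_weight is l (node_mode T l j) = subtree_weight is l j"
  by (simp add: col_weight_def inv_into_f_f[OF inj_on_node_mode])

lemma row_weight_Leaf:
  assumes "l \<le> depth T" "j < length (layer T l)" "layer T l ! j = Leaf i"
  shows "row_weight is l (node_mode T l j) r = of_bool (r = is ! i)"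
proof (cases "l = depth T")
  case True
  then show ?thesis
    using assms node_mode_less[OF assms(2)] by (simp add: row_weight_def node_mode_def)
next
  case False
  then show ?thesis
    using assms node_mode_less[OF assms(2)] by (simp add: row_weight_def node_mode_def)
qed

lemma row_weight_Node:
  assumes "j < length (layer T l)" "layer T l ! j = Node s t"
    and "y < dim_col (U (Suc l) (Suc (first_succ T l j)))"
  shows "row_weight is l (node_mode T l j) (x * dim_col (U (Suc l) (Suc (first_succ T l j))) + y)
       = subtree_weight is (Suc l) (first_succ T l j) x
         * subtree_weight is (Suc l) (Suc (first_succ T l j)) y"
  using assms Node_layer_less[OF assms(1,2)] node_mode_less[OF assms(1)]
  by (simp add: row_weight_def node_mode_def Let_def)

text \<open>This is the recursion of \<open>contract_cores\<close>, with the two sums over the successor ranks combined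
  into one sum over the rows of the matrix that was folded into the core.\<close>

lemma subtree_weight_eq:
  assumes "is": "is \<in> indices (dims Y)"
    and l: "1 \<le> l" "l \<le> depth T" and j: "j < length (layer T l)" and x: "x < dim_col (U l j)"
  shows "subtree_weight is l j x
       = (\<Sum>r<dim_row (U l j). row_weight is l (node_mode T l j) r * U l j $$ (r, x))"
proof (cases "layer T l ! j")
  case (Leaf i)
  note dims = dims_C_Leaf[OF l j Leaf]
  have "is ! i < ns ! i"
    using "is" dims(2) by (auto simp: indices_iff dims_Y ns nth_append dest!: spec[of _ i])
  then have "is ! i < dim_row (U l j)"
    using dims orthonormal_U[OF l j] by simp
  moreover have "(\<Sum>r<dim_row (U l j). row_weight is l (node_mode T l j) r * U l j $$ (r, x))
      = (\<Sum>r<dim_row (U l j). if r = is ! i then U l j $$ (r, x) else 0)"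
    by (intro sum.cong) (simp_all add: row_weight_Leaf[OF l(2) j Leaf])
  ultimately show ?thesis
    by (simp add: subtree_weight_def Leaf core[OF l j] node_core_def)
next
  case (Node s t)
  note succ = layer_successors[OF j Node]
  let ?a = "first_succ T l j"
  let ?ra = "dim_col (U (Suc l) ?a)" and ?rb = "dim_col (U (Suc l) (Suc ?a))"
  have "dim_row (U l j) = ?ra * ?rb"
    using orthonormal_U[OF l j] dims_C_Node[OF l(1) j Node] by simp
  then have "(\<Sum>r<dim_row (U l j). row_weight is l (node_mode T l j) r * U l j $$ (r, x))
      = (\<Sum>p<?ra. \<Sum>q<?rb. row_weight is l (node_mode T l j) (p * ?rb + q) * U l j $$ (p * ?rb + q, x))"
    by (simp add: sum_lessThan_mult)
  also have "\<dots> = (\<Sum>p<?ra. \<Sum>q<?rb. U l j $$ (p * ?rb + q, x)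
      * subtree_weight is (Suc l) ?a p * subtree_weight is (Suc l) (Suc ?a) q)"
    by (intro sum.cong refl) (simp add: row_weight_Node[OF j Node])
  also have "\<dots> = subtree_weight is l j x"
    using succ by (simp add: subtree_weight_def Node core[OF l j] node_core_def Let_def
        del: layer.simps)
  finally show ?thesis by simp
qed

text \<open>The compatibility needed in \<open>multilinear_eval_grouped\<close> to pass from \<open>C l\<close> to \<open>Cbar (l + 1)\<close>.\<close>

lemma row_weight_merge:
  assumes l: "1 \<le> l" "l < depth T" and js: "js \<in> indices (dims (Cbar (Suc l)))"
    and k: "k < length (source_groups T l (num_modes (Suc l)))"
  shows "row_weight is l k
           (grouped_index (source_groups T l (num_modes (Suc l))) (dims (Cbar (Suc l))) js ! k)
       = (\<Prod>m\<leftarrow>source_groups T l (num_modes (Suc l)) ! k. col_weight is (Suc l) m (js ! m))"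
proof -
  let ?ns = "dims (Cbar (Suc l))"
  have num_modes: "num_modes l = length (layer T l)" using l by (simp add: num_modes_def)
  have grouped: "grouped_index (source_groups T l (num_modes (Suc l))) ?ns js ! k
      = lin (map ((!) ?ns) (source_groups T l (num_modes (Suc l)) ! k))
            (map ((!) js) (source_groups T l (num_modes (Suc l)) ! k))"
    using k by (simp add: grouped_index_def)
  show ?thesis
  proof (cases "k = num_modes l")
    case True
    then have "source_groups T l (num_modes (Suc l)) ! k = [num_modes (Suc l)]"
      by (simp add: source_groups_def num_modes nth_append)
    then show ?thesis
      unfolding grouped using True batch_not_node_mode
      by (simp add: row_weight_def col_weight_def del: layer.simps)
  next
    case False
    then have j: "k < length (layer T l)"
      using k by (simp add: source_groups_def num_modes)
    then have group: "source_groups T l (num_modes (Suc l)) ! k = source_modes T l k"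
      by (simp add: source_groups_def nth_append)
    have mode: "node_mode T l k = k" using l by (simp add: node_mode_def)
    show ?thesis
    proof (cases "layer T l ! k")
      case (Leaf i)
      note pen = penultimate_leaf[OF l(2) j Leaf]
      have "i < d" using dims_C_Leaf(2)[OF l(1) _ j Leaf] l by simp
      then have "col_weight is (Suc l) i (js ! i) = of_bool (js ! i = is ! i)"
        using pen by (simp add: col_weight_def row_weight_def num_modes_def del: layer.simps)
      then show ?thesis
        unfolding grouped group using row_weight_Leaf[OF _ j Leaf] l mode Leaf
        by (simp add: source_modes_def)
    next
      case (Node s t)
      let ?a = "first_succ T l k"
      note succ = layer_successors[OF j Node]
      have less: "node_mode T (Suc l) (Suc ?a) < length ?ns"
        using node_mode_less[OF succ(1)] length_dims_Cbar[of "Suc l"] l by simp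
      have dims: "?ns ! node_mode T (Suc l) (Suc ?a) = dim_col (U (Suc l) (Suc ?a))"
        using dims_Cbar_node[OF _ _ succ(1)] l by simp
      then have "js ! node_mode T (Suc l) (Suc ?a) < dim_col (U (Suc l) (Suc ?a))"
        using js less by (metis indices_iff)
      then show ?thesis
        unfolding grouped group
        using row_weight_Node[OF j Node] mode Node dims col_weight_node[OF succ(1)]
          col_weight_node[OF Suc_lessD[OF succ(1)]]
        by (simp add: source_modes_def del: layer.simps)
    qed
  qed
qed

text \<open>Evaluating the root core on the weights of its two successors, and on the unit vector of the
  batch index, is the outermost step of \<open>contract_cores\<close>. For \<open>d = 2\<close> the modes are numbered by
  dimension, and the adjacency of sibling leaves ensures that the left successor is the
  first mode.\<close>

lemma root_eval:
  assumes "is": "is \<in> indices (dims Y)"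
  shows "multilinear_eval (dims (Cbar 1)) (entry (Cbar 1)) (col_weight is 1)
       = contract_cores T G T 0 0 is (is ! d)"
proof -
  obtain s t where st: "T = Node s t" by (rule root_Node)
  have layer1: "layer T 1 = [s, t]" by (simp add: st)
  have mode: "node_mode T 1 0 = 0 \<and> node_mode T 1 1 = 1"
  proof (cases "depth T = 1")
    case True
    then obtain i i' where ii: "s = Leaf i" "t = Leaf i'"
      using st by (cases s; cases t) auto
    then have "i' = Suc i" using sibling_leaves[of i i' 0] st by simp
    moreover have "d = 2" using num_modes_1 True by (simp add: num_modes_def)
    then have "0 \<in> set (leaves T)" by (simp add: set_leaves)
    then have "0 \<in> {i, i'}" using st ii by simp
    ultimately have "i = 0" by auto
    then show ?thesis using layer1 ii \<open>i' = Suc i\<close> True by (simp add: node_mode_def)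
  qed (simp add: node_mode_def)
  have len: "length (dims (Cbar 1)) = 3"
    using length_dims_Cbar[of 1] depth_pos num_modes_1 by simp
  then obtain n0 n1 n2 where dims: "dims (Cbar 1) = [n0, n1, n2]"
    by (auto simp: numeral_3_eq_3 length_Suc_conv)
  have "n2 = N" using batch_size_Cbar[of 1] depth_pos dims num_modes_1 by simp
  then have b: "is ! d < n2"
    using "is" by (auto simp: indices_iff dims_Y ns nth_append dest!: spec[of _ d])
  have w: "col_weight is 1 0 = subtree_weight is 1 0" "col_weight is 1 1 = subtree_weight is 1 1"
    using col_weight_node[of 0 1] col_weight_node[of 1 1] mode layer1
    by (simp_all del: layer.simps)
  have w2: "col_weight is 1 2 = (\<lambda>r. of_bool (r = is ! d))"
    using batch_not_node_mode[of 1] num_modes_1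
    by (simp add: col_weight_def row_weight_def fun_eq_iff del: layer.simps)
  have prod: "(\<Prod>k<length [n0, n1, n2]. u k ([x, y, z] ! k)) = u 0 x * u 1 y * u 2 z"
    for u :: "nat \<Rightarrow> nat \<Rightarrow> real" and x y z
    by (simp add: eval_nat_numeral)
  have "multilinear_eval (dims (Cbar 1)) (entry (Cbar 1)) (col_weight is 1)
      = (\<Sum>x<n0. \<Sum>y<n1. \<Sum>z<n2. if z = is ! d then entry (Cbar 1) [x, y, z]
           * (subtree_weight is 1 0 x * subtree_weight is 1 1 y) else 0)"
    unfolding multilinear_eval_def dims sum_indices_Cons indices_Nil
    by (intro sum.cong refl) (simp only: sum.insert finite.emptyI empty_iff not_False_eq_True
        sum.empty prod w w2 of_bool_def mult_1_right mult_zero_right add_0_right if_distrib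
        split: if_split, simp)
  also have "\<dots> = (\<Sum>x<n0. \<Sum>y<n1. entry (Cbar 1) [x, y, is ! d]
           * (subtree_weight is 1 0 x * subtree_weight is 1 1 y))"
    using b by simp
  also have "\<dots> = contract_cores T G (Node s t) 0 0 is (is ! d)"
    using layer1 dims[unfolded One_nat_def] by (simp add: G_root subtree_weight_def first_succ_def mult.assoc)
  finally show ?thesis by (simp only: st[symmetric])
qed


section \<open>The error estimate\<close>

text \<open>The error bound and the evaluation property of an approximation \<open>Z\<close> of \<open>Cbar l\<close> pass to an
  approximation \<open>Z'\<close> of \<open>C l\<close>, obtained by multiplying \<open>Z\<close> with the matrices of layer \<open>l\<close>. The value
  \<open>R is\<close> stands for the entry of the reconstruction.\<close>

lemma expand_layer:
  assumes l: "1 \<le> l" "l \<le> depth T"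
    and Z: "sqdist (dims (Cbar l)) (entry (Cbar l)) Z \<le> B"
    and eval: "\<And>is. is \<in> indices (dims Y) \<Longrightarrow>
      multilinear_eval (dims (Cbar l)) Z (col_weight is l) = R is"
  shows "\<exists>Z'. sqdist (dims (C l)) (entry (C l)) Z' \<le> real (length (layer T l)) * eps\<^sup>2 + B \<and>
    (\<forall>is\<in>indices (dims Y). multilinear_eval (dims (C l)) Z' (row_weight is l) = R is)"
proof (intro exI conjI ballI)
  let ?Z' = "foldr (\<lambda>j. mode_prod (node_mode T l j) (U l j)) (nodes l) Z"
  have inj: "inj_on (node_mode T l) (set (nodes l))"
    using inj_on_node_mode by (simp add: atLeast0LessThan)
  have less: "node_mode T l j < length (dims (C l))" if "j \<in> set (nodes l)" for j
    using that node_mode_less length_dims_C[OF l] by (simp add: less_SucI)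
  have U: "orthonormal_cols (U l j)" "dim_row (U l j) = dims (C l) ! node_mode T l j"
    if "j \<in> set (nodes l)" for j
    using that orthonormal_U[OF l] by auto
  \<comment> \<open>one truncation error per node of the layer\<close>
  have "(\<Sum>j\<leftarrow>nodes l. proj_error (dims (C l)) (node_mode T l j) (U l j) (entry (C l)))
      \<le> (\<Sum>j\<leftarrow>nodes l. eps\<^sup>2)"
  proof (rule sum_list_mono)
    fix j assume j: "j \<in> set (nodes l)"
    then obtain S V where "truncated_svd (unfold_mode (node_mode T l j) (C l)) (U l j) S V"
      "mat_frob (unfold_mode (node_mode T l j) (C l) - U l j * S * transpose_mat V) \<le> eps"
      using svd[OF l, of j] by auto
    then show "proj_error (dims (C l)) (node_mode T l j) (U l j) (entry (C l)) \<le> eps\<^sup>2"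
      by (rule proj_error_truncated_svd[OF less[OF j]])
  qed
  also have "\<dots> = real (length (layer T l)) * eps\<^sup>2"
    by (simp add: sum_list_triv)
  finally show "sqdist (dims (C l)) (entry (C l)) ?Z' \<le> real (length (layer T l)) * eps\<^sup>2 + B"
    using layer_pythagoras[OF distinct_upt inj less U, of Z] Z
    by (simp add: dims_Cbar[OF l] Cbar[OF l] contract_layer_def dims_fold_mode_mult)
  fix "is" assume "is": "is \<in> indices (dims Y)"
  have "multilinear_eval (dims (C l)) ?Z' (row_weight is l)
      = multilinear_eval (dims (Cbar l)) Z (col_weight is l)"
    unfolding dims_Cbar[OF l]
  proof (rule multilinear_eval_layer[OF distinct_upt inj less U(2)])
    fix j x assume "j \<in> set (nodes l)" "x < dim_col (U l j)"
    then show "col_weight is l (node_mode T l j) x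
        = (\<Sum>r<dim_row (U l j). row_weight is l (node_mode T l j) r * U l j $$ (r, x))"
      using subtree_weight_eq[OF "is" l] by (simp add: col_weight_node)
  next
    fix k x assume "k \<notin> node_mode T l ` set (nodes l)"
    then show "col_weight is l k x = row_weight is l k x"
      by (simp add: col_weight_def atLeast0LessThan)
  qed
  then show "multilinear_eval (dims (C l)) ?Z' (row_weight is l) = R is"
    using eval[OF "is"] by simp
qed

text \<open>Composition with \<open>merge_index\<close> undoes the merging; neither the distance nor the value of the
  multilinear form changes.\<close>

lemma split_modes:
  assumes l: "1 \<le> l" "l < depth T"
  shows "sqdist (dims (C l)) (entry (C l)) Z = sqdist (dims (Cbar (Suc l))) (entry (Cbar (Suc l)))
           (\<lambda>js. Z (merge_index T l (dims (Cbar (Suc l))) js))"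
    and "multilinear_eval (dims (Cbar (Suc l)))
           (\<lambda>js. Z (merge_index T l (dims (Cbar (Suc l))) js)) (col_weight is (Suc l))
       = multilinear_eval (dims (C l)) Z (row_weight is l)"
proof -
  note part = source_groups_partition[OF l(2)]
  have len: "length (dims (Cbar (Suc l))) = Suc (num_modes (Suc l))"
    using l by (intro length_dims_Cbar) auto
  show "sqdist (dims (C l)) (entry (C l)) Z = sqdist (dims (Cbar (Suc l))) (entry (Cbar (Suc l)))
           (\<lambda>js. Z (merge_index T l (dims (Cbar (Suc l))) js))"
    unfolding C_merge[OF l] using part len by (intro sqdist_merge_modes) auto
  have "multilinear_eval (dims (C l)) Z (row_weight is l)
      = multilinear_eval (dims (Cbar (Suc l)))
          (\<lambda>js. Z (grouped_index (source_groups T l (num_modes (Suc l))) (dims (Cbar (Suc l))) js))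
          (col_weight is (Suc l))"
    unfolding dims_C_merged[OF l]
    using part len row_weight_merge[OF l] by (intro multilinear_eval_grouped) auto
  also have "\<dots> = multilinear_eval (dims (Cbar (Suc l)))
           (\<lambda>js. Z (merge_index T l (dims (Cbar (Suc l))) js)) (col_weight is (Suc l))"
    by (rule multilinear_eval_cong) (simp_all add: merge_index_grouped[OF len])
  finally show "multilinear_eval (dims (Cbar (Suc l)))
           (\<lambda>js. Z (merge_index T l (dims (Cbar (Suc l))) js)) (col_weight is (Suc l))
       = multilinear_eval (dims (C l)) Z (row_weight is l)" by simp
qed

text \<open>The induction starts with the root core itself, whose error relative to \<open>Cbar 1\<close> is zero.\<close>

lemma partial_reconstruction:
  assumes "1 \<le> l" "l \<le> depth T"
  shows "\<exists>Z. sqdist (dims (C l)) (entry (C l)) Z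
              \<le> real (\<Sum>m=1..l. length (layer T m)) * eps\<^sup>2 \<and>
    (\<forall>is\<in>indices (dims Y). multilinear_eval (dims (C l)) Z (row_weight is l)
              = contract_cores T G T 0 0 is (is ! d))"
  using assms
proof (induction l rule: nat_induct_at_least)
  case base
  have "sqdist (dims (Cbar 1)) (entry (Cbar 1)) (entry (Cbar 1)) \<le> 0"
    by (simp add: sqdist_def)
  from expand_layer[OF _ _ this root_eval] show ?case using base by simp
next
  case (Suc l)
  then obtain Z where Z: "sqdist (dims (C l)) (entry (C l)) Z
              \<le> real (\<Sum>m=1..l. length (layer T m)) * eps\<^sup>2"
    "\<forall>is\<in>indices (dims Y). multilinear_eval (dims (C l)) Z (row_weight is l)
              = contract_cores T G T 0 0 is (is ! d)"
    by auto
  have l: "1 \<le> l" "l < depth T" using Suc by auto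
  have "\<exists>Z'. sqdist (dims (C (Suc l))) (entry (C (Suc l))) Z'
        \<le> real (length (layer T (Suc l))) * eps\<^sup>2
          + real (\<Sum>m=1..l. length (layer T m)) * eps\<^sup>2 \<and>
      (\<forall>is\<in>indices (dims Y). multilinear_eval (dims (C (Suc l))) Z' (row_weight is (Suc l))
        = contract_cores T G T 0 0 is (is ! d))"
    by (rule expand_layer[where Z = "\<lambda>js. Z (merge_index T l (dims (Cbar (Suc l))) js)"])
      (use Z l split_modes[OF l] in auto)
  then show ?case
    by (simp add: distrib_right add.commute del: layer.simps)
qed

lemma leaf_size_eq:
  assumes "j < length (layer T l)" "layer T l ! j = s" "i \<in> set (leaves s)"
  shows "leaf_size T G i s l j = ns ! i"
  using assms
proof (induction s arbitrary: l j)
  case (Leaf i')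
  have l: "1 \<le> l" "l \<le> depth T"
  proof -
    show "l \<le> depth T" using depth_in_layer[OF nth_mem[OF Leaf(1)]] by simp
    obtain s t where "T = Node s t" by (rule root_Node)
    then show "1 \<le> l" using Leaf by (cases l) auto
  qed
  show ?case
    using Leaf dims_C_Leaf(1)[OF l Leaf(1,2)] orthonormal_U[OF l Leaf(1)] core[OF l Leaf(1)]
    by (simp add: node_core_def)
next
  case (Node s t)
  note succ = layer_successors[OF Node.prems(1,2)]
  show ?case
    using Node.IH(1)[OF Suc_lessD[OF succ(1)] succ(2)] Node.IH(2)[OF succ(1,3)] Node.prems(3)
    by auto
qed

lemma dims_reconstruct: "dims (reconstruct T G) = dims Y"
proof -
  have "map (\<lambda>i. leaf_size T G i T 0 0) [0..<d] = map ((!) ns) [0..<d]"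
    using set_leaves by (intro map_cong refl leaf_size_eq) auto
  moreover have "map ((!) ns) [0..<d] = ns" using map_nth[of ns] ns by simp
  moreover have "dims (G 0 0) ! 2 = N"
  proof -
    show ?thesis using batch_size_Cbar[of 1] depth_pos num_modes_1 by (simp add: G_root)
  qed
  ultimately show ?thesis
    by (simp add: reconstruct_def Let_def length_leaves dims_Y)
qed

lemma error_bound:
  "(tensor_frob (Y - reconstruct T G))\<^sup>2 \<le> real (2 * d - 2) * eps\<^sup>2"
proof -
  obtain Z where Z: "sqdist (dims Y) (entry Y) Z
              \<le> real (\<Sum>m=1..depth T. length (layer T m)) * eps\<^sup>2"
    and eval: "\<forall>is\<in>indices (dims Y). multilinear_eval (dims Y) Z (row_weight is (depth T))
              = contract_cores T G T 0 0 is (is ! d)"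
    using partial_reconstruction[OF depth_pos order_refl] by (auto simp: C_last)
  have "Z is = entry (reconstruct T G) is" if "is \<in> indices (dims Y)" for "is"
  proof -
    \<comment> \<open>in the last layer all weights are unit vectors\<close>
    have "row_weight is (depth T) = (\<lambda>k x. of_bool (x = is ! k))"
      by (auto simp: row_weight_def fun_eq_iff num_modes_def)
    then have "Z is = contract_cores T G T 0 0 is (is ! d)"
      using bspec[OF eval that] multilinear_eval_point[OF that, of Z] by (simp only:)
    then show ?thesis by (simp add: reconstruct_def Let_def length_leaves)
  qed
  then have "(tensor_frob (Y - reconstruct T G))\<^sup>2 = sqdist (dims Y) (entry Y) Z"
    by (simp add: tensor_frob_def minus_tensor_def sqdist_def sum_nonneg)
  then show ?thesis using Z by (simp only: sum_length_nonroot_layers)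
qed

text \<open>The tree has a node besides the root, and the norm of its residual is a lower bound.\<close>

lemma eps_nonneg: "0 \<le> eps"
proof -
  obtain s t where st: "T = Node s t" by (rule root_Node)
  then obtain X where "mat_frob X \<le> eps" using svd[of 1 0] depth_pos by auto
  moreover have "0 \<le> mat_frob X" by (simp add: mat_frob_def sum_nonneg)
  ultimately show ?thesis by simp
qed

end

theorem corollary4:
  fixes d N :: nat and ns :: "nat list" and Y Y' :: tensor and T :: dim_tree
    and G :: "nat \<Rightarrow> nat \<Rightarrow> tensor" and eps_abs eps_nw :: real
  assumes "d \<ge> 2"
    and "length ns = d"
    and "dims Y = ns @ [N]"
    and "dimension_tree d T"
    and "BHT_l2r T Y eps_nw G"
    and "Y' = reconstruct T G"
    and "eps_nw = eps_abs / sqrt (2 * real d - 2)"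
  shows "dims Y' = dims Y \<and> tensor_frob (Y - Y') \<le> eps_abs"
proof -
  obtain C Cbar U where run: "C (depth T) = Y" "G 0 0 = Cbar 1"
    and layers: "\<forall>l\<in>{1..depth T}.
           (\<forall>j<length (layer T l).
              (\<exists>S V. truncated_svd (unfold_mode (node_mode T l j) (C l)) (U l j) S V \<and>
                     mat_frob (unfold_mode (node_mode T l j) (C l)
                               - U l j * S * transpose_mat V) \<le> eps_nw) \<and>
              G l j = node_core T U l j) \<and>
           Cbar l = contract_layer T l (U l) (C l) \<and>
           (l > 1 \<longrightarrow> C (l - 1) = merge_modes T (l - 1) (Cbar l))"
    using assms(5) unfolding BHT_l2r_def by blast
  have merge: "C l = merge_modes T l (Cbar (Suc l))" if "1 \<le> l" "l < depth T" for l
    using bspec[OF layers, of "Suc l"] that by simp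
  interpret BHT_run d T Y ns N C Cbar U G eps_nw
    by unfold_locales (use assms(1-4) run layers merge in \<open>simp_all del: layer.simps\<close>)
  have pos: "0 < 2 * real d - 2" using assms(1) by simp
  have "(tensor_frob (Y - Y'))\<^sup>2 \<le> (sqrt (2 * real d - 2) * eps_nw)\<^sup>2"
    using error_bound assms(1,6) by (simp add: power_mult_distrib of_nat_diff)
  then have "tensor_frob (Y - Y') \<le> sqrt (2 * real d - 2) * eps_nw"
    by (rule power2_le_imp_le) (use pos eps_nonneg in simp)
  also have "\<dots> = eps_abs" using pos assms(7) by simp
  finally show ?thesis using dims_reconstruct assms(6) by simp
qed

end
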